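(* Let $K$ be a field of characteristic $0$, let $E/K$ be an elliptic curve over $K$, and let $f\in K[x]$ be a monic polynomial of degree $n\ge 5$ with zeros $\alpha_{1},\alpha_{2},\ldots,\alpha_{n}$ in an algebraic closure of $K$. Suppose that the Galois group $\operatorname{Gal}(f/K)$ of $f$ over $K$ is isomorphic to the symmetric group $\mathfrak{S}_{n}$ of degree $n$. Let $L/K$ be the extension obtained by adjoining any $n-2$ of the zeros $\alpha_i$, say (after reordering) $L:=K(\alpha_{3},\alpha_{4},\ldots,\alpha_{n})$. Then the torsion subgroup of $E$ does not grow over $L$, i.e., $$E(L)_{\mathrm{tors}}=E(K)_{\mathrm{tors}}.$$
   Context: $E(F)_{\mathrm{tors}}$ denotes the torsion subgroup of the group $E(F)$ of $F$-rational points of $E$. $\operatorname{Gal}(f/K)$ is the Galois group over $K$ of the splitting field of $f$. *)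

theory Defs
  imports
    "HOL-Algebra.Algebraic_Closure_Type"
    "HOL-Algebra.Generated_Fields"
    "HOL-Algebra.Bij"
    "HOL-Algebra.Sym_Groups"
begin

section \<open>Field extensions and Galois groups\<close>

text \<open>
  The ambient field is a whole type \<open>'a\<close>, viewed through \<^const>\<open>ring_of_type_algebra\<close>;
  all other fields are subfields of it, given as sets.
\<close>

definition adjoin :: "'a::field set \<Rightarrow> 'a set \<Rightarrow> 'a set"
  where "adjoin K S = generate_field ring_of_type_algebra (K \<union> S)"

text \<open>
  This is the splitting field of \<open>f\<close> over \<open>K\<close> only when \<open>f\<close> splits in the type \<open>'a\<close>,
  e.g. when \<open>'a\<close> is an algebraic closure of \<open>K\<close>.
\<close>

definition splitting_field :: "'a::field set \<Rightarrow> 'a poly \<Rightarrow> 'a set"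
  where "splitting_field K f = adjoin K {x. poly f x = 0}"

text \<open>
  As in \<^const>\<open>AutoGroup\<close>, automorphisms of \<open>F\<close> are represented by functions that are
  \<open>undefined\<close> outside \<open>F\<close>, and the group operation is composition.
\<close>

definition field_aut_group :: "'a::field set \<Rightarrow> 'a set \<Rightarrow> ('a \<Rightarrow> 'a) monoid"
  where "field_aut_group F K =
    BijGroup F \<lparr>carrier := {\<sigma> \<in> Bij F.
      \<sigma> \<in> ring_hom (ring_of_type_algebra\<lparr>carrier := F\<rparr>) (ring_of_type_algebra\<lparr>carrier := F\<rparr>) \<and>
      (\<forall>x\<in>K. \<sigma> x = x)}\<rparr>"

definition Gal :: "'a::field poly \<Rightarrow> 'a set \<Rightarrow> ('a \<Rightarrow> 'a) monoid"
  where "Gal f K = field_aut_group (splitting_field K f) K"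


section \<open>Elliptic curves\<close>

text \<open>
  An elliptic curve is given by a Weierstrass equation
  \[ y^2 + a_1 x y + a_3 y = x^3 + a_2 x^2 + a_4 x + a_6 \]
  with nonzero discriminant; the identity of its group is the point at infinity.
\<close>

record 'a weierstrass =
  a1 :: 'a
  a2 :: 'a
  a3 :: 'a
  a4 :: 'a
  a6 :: 'a

definition b2 :: "'a::field weierstrass \<Rightarrow> 'a"
  where "b2 E = (a1 E)\<^sup>2 + 4 * a2 E"

definition b4 :: "'a::field weierstrass \<Rightarrow> 'a"
  where "b4 E = 2 * a4 E + a1 E * a3 E"

definition b6 :: "'a::field weierstrass \<Rightarrow> 'a"
  where "b6 E = (a3 E)\<^sup>2 + 4 * a6 E"

definition b8 :: "'a::field weierstrass \<Rightarrow> 'a"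
  where "b8 E = (a1 E)\<^sup>2 * a6 E + 4 * a2 E * a6 E - a1 E * a3 E * a4 E
                + a2 E * (a3 E)\<^sup>2 - (a4 E)\<^sup>2"

definition discriminant :: "'a::field weierstrass \<Rightarrow> 'a"
  where "discriminant E = - (b2 E)\<^sup>2 * b8 E - 8 * b4 E ^ 3 - 27 * (b6 E)\<^sup>2
                          + 9 * b2 E * b4 E * b6 E"

definition elliptic_curve_over :: "'a::field set \<Rightarrow> 'a weierstrass \<Rightarrow> bool"
  where "elliptic_curve_over K E \<longleftrightarrow>
    a1 E \<in> K \<and> a2 E \<in> K \<and> a3 E \<in> K \<and> a4 E \<in> K \<and> a6 E \<in> K \<and> discriminant E \<noteq> 0"

datatype 'a point = Infinity | Affine 'a 'a

fun on_curve :: "'a::field weierstrass \<Rightarrow> 'a point \<Rightarrow> bool" where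
  "on_curve E Infinity = True"
| "on_curve E (Affine x y) =
     (y\<^sup>2 + a1 E * x * y + a3 E * y = x ^ 3 + a2 E * x\<^sup>2 + a4 E * x + a6 E)"

fun rational_over :: "'a set \<Rightarrow> 'a point \<Rightarrow> bool" where
  "rational_over F Infinity = True"
| "rational_over F (Affine x y) = (x \<in> F \<and> y \<in> F)"

text \<open>
  The chord-tangent law.  Two affine points with equal first coordinate are mutually inverse
  iff \<open>y1 + y2 + a1 x2 + a3 = 0\<close>; otherwise \<open>y = l x + v\<close> is the chord through them, or the
  tangent if they coincide.
\<close>

fun point_add :: "'a::field weierstrass \<Rightarrow> 'a point \<Rightarrow> 'a point \<Rightarrow> 'a point" where
  "point_add E Infinity Q = Q"
| "point_add E (Affine x1 y1) Infinity = Affine x1 y1"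
| "point_add E (Affine x1 y1) (Affine x2 y2) =
    (if x1 = x2 \<and> y1 + y2 + a1 E * x2 + a3 E = 0 then Infinity
     else
       let l = (if x1 = x2
                then (3 * x1\<^sup>2 + 2 * a2 E * x1 + a4 E - a1 E * y1) / (2 * y1 + a1 E * x1 + a3 E)
                else (y2 - y1) / (x2 - x1));
           v = y1 - l * x1;
           x3 = l\<^sup>2 + a1 E * l - a2 E - x1 - x2
       in Affine x3 (- (l + a1 E) * x3 - v - a3 E))"

text \<open>The group \<open>E(F)\<close>, written multiplicatively to fit \<^const>\<open>pow\<close> on monoids.\<close>

definition rational_points :: "'a::field weierstrass \<Rightarrow> 'a set \<Rightarrow> 'a point monoid"
  where "rational_points E F =
    \<lparr>carrier = {P. on_curve E P \<and> rational_over F P}, monoid.mult = point_add E, one = Infinity\<rparr>"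

definition torsion_subgroup :: "('b, 'c) monoid_scheme \<Rightarrow> 'b set"
  where "torsion_subgroup G = {x \<in> carrier G. \<exists>m::nat. m > 0 \<and> x [^]\<^bsub>G\<^esub> m = \<one>\<^bsub>G\<^esub>}"

end

theory Submission
  imports Defs
begin

text \<open>
  The Galois group acts on the torsion points. The proof plays the size of the symmetric group off
  against the smallness of torsion, which has rank at most two.

  Let \<open>M\<close> be the splitting field of \<open>f\<close> and \<open>A\<close> its set of roots. Since the Galois group has as
  many elements as there are permutations of \<open>n\<close> objects, the roots are distinct and every
  permutation of \<open>A\<close> is induced by an automorphism of \<open>M\<close> over \<open>K\<close>
  (\<open>Gal_embeds_in_root_permutations\<close>). A point \<open>P\<close> over \<open>L\<close> is fixed by the transposition of the two
  roots that were not adjoined. It suffices to show that a torsion point with this property is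
  fixed by \<^emph>\<open>all\<close> transpositions, because an element of \<open>M\<close> fixed by all transpositions lies in
  \<open>K\<close> (\<open>fixed_by_transpositions_imp_base\<close>).

  For this, every double transposition is shown to fix all torsion of \<open>E(M)\<close>; composing with the
  transposition that fixes \<open>P\<close> then yields the other transpositions. Torsion is split into its odd
  and its 2-primary part.

  \<^item> Odd part. The three double transpositions of four letters generate a Klein four group, and
    a 3-cycle permutes them cyclically. On odd torsion the Klein group is diagonalisable with eigenvalues
    \<open>1\<close> and \<open>-1\<close>, and the 3-cycle permutes the three nontrivial eigenspaces. A nonzero eigenvector
    of order \<open>e\<close> would therefore produce three independent elements of order \<open>e\<close> and hence \<open>e\<^sup>3\<close>
    points killed by \<open>e\<close>, too many (\<open>klein_four_fixes_odd_torsion\<close>).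
  \<^item> 2-primary part. An automorphism of order five cannot move any of the at most three points of
    order two, and then by induction it fixes all points of 2-power order
    (\<open>five_cycle_fixes_two_power_torsion\<close>). Double transpositions are products of two 5-cycles;
    this is one place where \<open>n \<ge> 5\<close> enters.

  The bound on torsion comes from polynomials whose roots include the \<open>x\<close>-coordinates of the
  \<open>m\<close>-torsion points (\<open>torsion_polynomial\<close>). They are not the usual division polynomials but the
  output of a doubling recursion on \<open>x\<close>-coordinates. It leaves spurious factors, but the degree
  stays below \<open>3m\<^sup>2/2\<close>, so that fewer than \<open>m\<^sup>3\<close> points are killed by \<open>m \<ge> 3\<close>. The leading
  coefficient \<open>m\<^sup>2\<close> shows that these polynomials do not vanish identically, as the characteristic
  is \<open>0\<close>.

  All this needs the group law on \<open>E\<close>, whose associativity is proved here as well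
  (\<open>point_add_assoc\<close>), by a computation with slopes for points in general position, and translation by
  an auxiliary point for the rest.
\<close>

section \<open>Subfields of a field type\<close>

lemma ring_of_type_simps [simp]:
  "carrier ring_of_type_algebra = UNIV" "one ring_of_type_algebra = 1" "zero ring_of_type_algebra = 0"
  "monoid.mult ring_of_type_algebra = (*)" "add ring_of_type_algebra = (+)"
  by (simp_all add: ring_of_type_algebra_def)

lemma ring_of_type_uminus [simp]: "a_inv ring_of_type_algebra (x :: 'a::field) = - x"
proof -
  interpret R: field "ring_of_type_algebra :: 'a ring" by (rule field_from_type_algebra)
  show ?thesis using R.minus_equality[of "- x" x] by simp
qed

lemma ring_of_type_inverse [simp]:
  assumes "x \<noteq> (0 :: 'a::field)"
  shows "m_inv ring_of_type_algebra x = inverse x"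
proof -
  interpret R: field "ring_of_type_algebra :: 'a ring" by (rule field_from_type_algebra)
  show ?thesis using R.comm_inv_char[of x "inverse x"] assms by simp
qed

lemma subfield_of_type_iff:
  fixes F :: "'a::field set"
  shows "subfield F ring_of_type_algebra \<longleftrightarrow> 1 \<in> F \<and> (\<forall>x\<in>F. - x \<in> F \<and> inverse x \<in> F) \<and>
    (\<forall>x\<in>F. \<forall>y\<in>F. x + y \<in> F \<and> x * y \<in> F)" (is "_ \<longleftrightarrow> ?R")
proof -
  interpret R: field "ring_of_type_algebra :: 'a ring" by (rule field_from_type_algebra)
  show ?thesis
  proof
    assume F: "subfield F ring_of_type_algebra"
    have "inverse x \<in> F" if "x \<in> F" for x
      using R.subfield_m_inv(1)[OF F, of x] subringE(2)[OF subfieldE(1)[OF F]] that by (cases "x = 0") auto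
    thus ?R using subringE[OF subfieldE(1)[OF F]] by auto
  next
    assume ?R
    thus "subfield F ring_of_type_algebra"
      by (intro R.subfieldI' R.subringI) auto
  qed
qed

lemma subfield_closed:
  fixes F :: "'a::field set"
  assumes F: "subfield F ring_of_type_algebra"
  shows "0 \<in> F" "1 \<in> F" "numeral k \<in> F" "x \<in> F \<Longrightarrow> - x \<in> F" "x \<in> F \<Longrightarrow> inverse x \<in> F"
    "x \<in> F \<Longrightarrow> y \<in> F \<Longrightarrow> x + y \<in> F" "x \<in> F \<Longrightarrow> y \<in> F \<Longrightarrow> x - y \<in> F" 
    "x \<in> F \<Longrightarrow> y \<in> F \<Longrightarrow> x * y \<in> F" "x \<in> F \<Longrightarrow> y \<in> F \<Longrightarrow> x / y \<in> F" "x \<in> F \<Longrightarrow> x ^ n \<in> F"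
proof -
  have F': "1 \<in> F" "\<And>x. x \<in> F \<Longrightarrow> - x \<in> F" "\<And>x. x \<in> F \<Longrightarrow> inverse x \<in> F"
    "\<And>x y. x \<in> F \<Longrightarrow> y \<in> F \<Longrightarrow> x + y \<in> F" "\<And>x y. x \<in> F \<Longrightarrow> y \<in> F \<Longrightarrow> x * y \<in> F"
    using F unfolding subfield_of_type_iff by auto
  show 0: "0 \<in> F" using F'(1) F'(4)[OF F'(1) F'(2)[OF F'(1)]] by simp
  have "of_nat m \<in> F" for m by (induction m) (auto simp: 0 F')
  from this[of "numeral k"] show "numeral k \<in> F" by simp
  show "x \<in> F \<Longrightarrow> y \<in> F \<Longrightarrow> x - y \<in> F" using F'(4)[of x "- y"] F'(2) by simp
  show "x \<in> F \<Longrightarrow> y \<in> F \<Longrightarrow> x / y \<in> F" using F'(5)[of x "inverse y"] F'(3) by (simp add: divide_inverse)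
  show "x \<in> F \<Longrightarrow> x ^ n \<in> F" by (induction n) (auto simp: F')
qed (use F in \<open>auto simp: subfield_of_type_iff\<close>)

section \<open>The group law\<close>

fun neg_point :: "'a::field weierstrass \<Rightarrow> 'a point \<Rightarrow> 'a point" where
  "neg_point E Infinity = Infinity"
| "neg_point E (Affine x y) = Affine x (- y - a1 E * x - a3 E)"

text \<open>
  The second equation is the difference of the two curve equations divided by \<open>x1 - x2\<close>, so for
  points of the curve it is automatic if their \<open>x\<close>-coordinates differ, while for equal points it says that \<open>l\<close> is the slope of
  the tangent. Chords and tangents can thus be treated by the same algebra.
\<close>

definition is_slope :: "'a::field weierstrass \<Rightarrow> 'a \<Rightarrow> 'a \<Rightarrow> 'a \<Rightarrow> 'a \<Rightarrow> 'a \<Rightarrow> bool" where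
  "is_slope E x1 y1 x2 y2 l \<longleftrightarrow> y1 - y2 = l * (x1 - x2) \<and>
     l * (y1 + y2 + a1 E * x1 + a3 E) =
       x1\<^sup>2 + x1 * x2 + x2\<^sup>2 + a2 E * (x1 + x2) + a4 E - a1 E * y2"

lemma on_curve_neg_point [simp]: "on_curve E (neg_point E P) = on_curve E P"
  by (cases P) (auto simp: algebra_simps power2_eq_square)

lemma same_x_cases:
  assumes "on_curve E (Affine x y1)" "on_curve E (Affine x y2)"
  shows "y1 = y2 \<or> y1 + y2 + a1 E * x + a3 E = 0"
proof -
  have "(y1 - y2) * (y1 + y2 + a1 E * x + a3 E) = 0"
    using assms by (simp add: algebra_simps power2_eq_square)
  thus ?thesis by auto
qed

lemma slope_exists:
  assumes "on_curve E (Affine x1 y1)" "on_curve E (Affine x2 y2)"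
    and "\<not> (x1 = x2 \<and> y1 + y2 + a1 E * x2 + a3 E = 0)"
  shows "\<exists>l. is_slope E x1 y1 x2 y2 l"
proof (cases "x1 = x2")
  case True
  with assms same_x_cases[of E x1 y1 y2] have "y1 = y2" "2 * y1 + a1 E * x1 + a3 E \<noteq> 0" by auto
  with True show ?thesis
    by (intro exI[of _ "(3 * x1\<^sup>2 + 2 * a2 E * x1 + a4 E - a1 E * y1) / (2 * y1 + a1 E * x1 + a3 E)"])
       (simp add: is_slope_def power2_eq_square)
next
  case False
  let ?l = "(y1 - y2) / (x1 - x2)"
  have l: "y1 - y2 = ?l * (x1 - x2)" using False by simp
  have e: "y1\<^sup>2 + a1 E * x1 * y1 + a3 E * y1 - (y2\<^sup>2 + a1 E * x2 * y2 + a3 E * y2)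
     = x1 ^ 3 + a2 E * x1\<^sup>2 + a4 E * x1 + a6 E - (x2 ^ 3 + a2 E * x2\<^sup>2 + a4 E * x2 + a6 E)"
    using assms by simp
  have "(x1 - x2) * (?l * (y1 + y2 + a1 E * x1 + a3 E)) = (y1 - y2) * (y1 + y2 + a1 E * x1 + a3 E)"
    using False by simp
  also have "\<dots> = (x1 - x2) * (x1\<^sup>2 + x1 * x2 + x2\<^sup>2 + a2 E * (x1 + x2) + a4 E - a1 E * y2)"
    using e by Groebner_Basis.algebra
  finally have "?l * (y1 + y2 + a1 E * x1 + a3 E)
      = x1\<^sup>2 + x1 * x2 + x2\<^sup>2 + a2 E * (x1 + x2) + a4 E - a1 E * y2"
    using False by simp
  with l show ?thesis unfolding is_slope_def by blast
qed

text \<open>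
  For points that are not mutually inverse the two equations determine the slope, so that any way of guessing a slope computes
  the sum; the proofs of cancellation and associativity use this.
\<close>

lemma point_add_slope:
  assumes "on_curve E (Affine x1 y1)" "on_curve E (Affine x2 y2)"
    and ninv: "\<not> (x1 = x2 \<and> y1 + y2 + a1 E * x2 + a3 E = 0)"
    and s: "is_slope E x1 y1 x2 y2 l"
    and x3: "x3 = l\<^sup>2 + a1 E * l - a2 E - x1 - x2"
  shows "point_add E (Affine x1 y1) (Affine x2 y2) = Affine x3 (- y1 - l * (x3 - x1) - a1 E * x3 - a3 E)"
proof -
  have "(if x1 = x2 then (3 * x1\<^sup>2 + 2 * a2 E * x1 + a4 E - a1 E * y1) / (2 * y1 + a1 E * x1 + a3 E)
         else (y2 - y1) / (x2 - x1)) = l"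
  proof (cases "x1 = x2")
    case True
    with assms same_x_cases[of E x1 y1 y2] have "y1 = y2" "2 * y1 + a1 E * x1 + a3 E \<noteq> 0" by auto
    with True s show ?thesis by (auto simp: is_slope_def field_simps power2_eq_square)
  next
    case False
    with s show ?thesis by (auto simp: is_slope_def field_simps)
  qed
  moreover have "- (l + a1 E) * x3 - (y1 - l * x1) - a3 E = - y1 - l * (x3 - x1) - a1 E * x3 - a3 E"
    by (simp add: algebra_simps)
  ultimately show ?thesis using ninv unfolding point_add.simps Let_def x3 by simp
qed

lemma point_add_inverse [simp]:
  "x1 = x2 \<Longrightarrow> y1 + y2 + a1 E * x2 + a3 E = 0 \<Longrightarrow> point_add E (Affine x1 y1) (Affine x2 y2) = Infinity"
  by simp

lemma point_add_Infinity_right [simp]: "point_add E P Infinity = P"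
  by (cases P) auto

lemma point_add_neg [simp]: "point_add E P (neg_point E P) = Infinity" "point_add E (neg_point E P) P = Infinity"
  by (cases P; simp)+

lemma affine_sum_cases:
  assumes "on_curve E (Affine x1 y1)" "on_curve E (Affine x2 y2)"
  obtains "x1 = x2" "y1 + y2 + a1 E * x2 + a3 E = 0"
  | l where "\<not> (x1 = x2 \<and> y1 + y2 + a1 E * x2 + a3 E = 0)" "is_slope E x1 y1 x2 y2 l"
      "point_add E (Affine x1 y1) (Affine x2 y2) =
        Affine (l\<^sup>2 + a1 E * l - a2 E - x1 - x2)
          (- y1 - l * ((l\<^sup>2 + a1 E * l - a2 E - x1 - x2) - x1) - a1 E * (l\<^sup>2 + a1 E * l - a2 E - x1 - x2) - a3 E)"
  using slope_exists[OF assms] point_add_slope[OF assms _ _ refl] by blast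

lemma slope_sym: "is_slope E x1 y1 x2 y2 l \<Longrightarrow> is_slope E x2 y2 x1 y1 l"
  unfolding is_slope_def by (intro conjI; elim conjE; Groebner_Basis.algebra)

lemma point_add_commute:
  assumes "on_curve E P" "on_curve E Q"
  shows "point_add E P Q = point_add E Q P"
proof (cases P; cases Q)
  fix x1 y1 x2 y2 assume PQ: "P = Affine x1 y1" "Q = Affine x2 y2"
  have c: "on_curve E (Affine x1 y1)" "on_curve E (Affine x2 y2)" using assms PQ by auto
  show ?thesis using c
  proof (cases rule: affine_sum_cases)
    case 1 thus ?thesis by (simp add: PQ add_ac)
  next
    case (2 l)
    have n: "\<not> (x2 = x1 \<and> y2 + y1 + a1 E * x1 + a3 E = 0)" using 2(1) by (auto simp: add_ac)
    show ?thesis unfolding PQ 2(3) point_add_slope[OF c(2,1) n slope_sym[OF 2(2)] refl]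
      using 2(2) unfolding is_slope_def by (simp; Groebner_Basis.algebra)
  qed
qed auto

lemma on_curve_point_add:
  assumes "on_curve E P" "on_curve E Q"
  shows "on_curve E (point_add E P Q)"
proof (cases P; cases Q)
  fix x1 y1 x2 y2 assume PQ: "P = Affine x1 y1" "Q = Affine x2 y2"
  have c: "on_curve E (Affine x1 y1)" "on_curve E (Affine x2 y2)" using assms PQ by auto
  show ?thesis using c
  proof (cases rule: affine_sum_cases)
    case 1 thus ?thesis by (simp add: PQ)
  next
    case (2 l)
    define x3 where "x3 = l\<^sup>2 + a1 E * l - a2 E - x1 - x2"
    show ?thesis unfolding PQ 2(3) x3_def[symmetric] on_curve.simps
      using 2(2) x3_def c(1) unfolding is_slope_def on_curve.simps by Groebner_Basis.algebra
  qed
qed (use assms in auto)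

lemma discriminant_singular:
  fixes E :: "'a::field_char_0 weierstrass"
  assumes "on_curve E (Affine x y)" "2 * y + a1 E * x + a3 E = 0"
    "3 * x\<^sup>2 + 2 * a2 E * x + a4 E - a1 E * y = 0"
  shows "discriminant E = 0"
  using assms unfolding discriminant_def b2_def b4_def b6_def b8_def on_curve.simps
  by Groebner_Basis.algebra

text \<open>
  The line through \<open>P + Q\<close> and \<open>-Q\<close> is the mirror image of the line through \<open>P\<close> and \<open>Q\<close>, so its
  slope is \<open>- l - a1\<close>. The chord-tangent law could only fail to see this if \<open>P + Q = Q\<close>; then the
  line would be tangent at a point of order two without being vertical, which makes that point
  singular.
\<close>

lemma point_add_neg_cancel:
  fixes E :: "'a::field_char_0 weierstrass"
  assumes "on_curve E P" "on_curve E Q" and disc: "discriminant E \<noteq> 0"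
  shows "point_add E (point_add E P Q) (neg_point E Q) = P"
proof (cases P; cases Q)
  fix x1 y1 x2 y2 assume PQ: "P = Affine x1 y1" "Q = Affine x2 y2"
  have c: "on_curve E (Affine x1 y1)" "on_curve E (Affine x2 y2)" using assms PQ by auto
  show ?thesis using c
  proof (cases rule: affine_sum_cases)
    case 1 
    from 1(2) have "y1 = - y2 - a1 E * x2 - a3 E" by (simp add: eq_diff_eq eq_neg_iff_add_eq_0 add_ac)
    with 1 show ?thesis by (simp add: PQ)
  next
    case (2 l)
    define x3 where "x3 = l\<^sup>2 + a1 E * l - a2 E - x1 - x2"
    define y3 where "y3 = - y1 - l * (x3 - x1) - a1 E * x3 - a3 E"
    define y2' where "y2' = - y2 - a1 E * x2 - a3 E"
    have sum: "point_add E P Q = Affine x3 y3" unfolding PQ 2(3) x3_def y3_def ..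
    have c3: "on_curve E (Affine x3 y3)" using on_curve_point_add[OF assms(1,2)] sum by simp
    have c2: "on_curve E (Affine x2 y2')" using c(2) on_curve_neg_point[of E Q] unfolding PQ neg_point.simps y2'_def by simp
    have sl: "is_slope E x3 y3 x2 y2' (- l - a1 E)"
      using 2(2) x3_def y3_def y2'_def c(1) unfolding is_slope_def on_curve.simps
      by (intro conjI; elim conjE; Groebner_Basis.algebra)
    have "\<not> (x3 = x2 \<and> y3 + y2' + a1 E * x2 + a3 E = 0)"
    proof
      assume *: "x3 = x2 \<and> y3 + y2' + a1 E * x2 + a3 E = 0"
      have t: "2 * y2 + a1 E * x2 + a3 E = 0"
        using * 2(2) x3_def y3_def y2'_def unfolding is_slope_def
        by (elim conjE) Groebner_Basis.algebra
      moreover have "3 * x2\<^sup>2 + 2 * a2 E * x2 + a4 E - a1 E * y2 = 0"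
        using * t 2(2) x3_def y3_def y2'_def unfolding is_slope_def
        by (elim conjE) Groebner_Basis.algebra
      ultimately show False using discriminant_singular[OF c(2)] disc by blast
    qed
    moreover have "x1 = (- l - a1 E)\<^sup>2 + a1 E * (- l - a1 E) - a2 E - x3 - x2"
      unfolding x3_def by Groebner_Basis.algebra
    moreover have "- y3 - (- l - a1 E) * (x1 - x3) - a1 E * x1 - a3 E = y1"
      unfolding y3_def by (simp add: algebra_simps)
    ultimately show ?thesis using point_add_slope[OF c3 c2 _ sl]
      unfolding sum unfolding PQ neg_point.simps y2'_def[symmetric] by metis
  qed
qed (use assms in auto)

lemma point_add_right_cancel:
  fixes E :: "'a::field_char_0 weierstrass"
  assumes "on_curve E P" "on_curve E Q" "on_curve E S" "discriminant E \<noteq> 0"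
    and "point_add E P S = point_add E Q S"
  shows "P = Q"
  using assms point_add_neg_cancel by metis

text \<open>
  Translate \<open>P2\<close> to the origin and put \<open>u = x1 - x2\<close>, \<open>v = x3 - x2\<close>. Let \<open>l\<close>, \<open>m\<close> be the slopes of
  \<open>P1 P2\<close> and \<open>P2 P3\<close>. Eliminating the curve coefficients leaves a single relation \<open>rel\<close> between the
  slopes and the denominators \<open>x3 - u12\<close>, \<open>x1 - u23\<close>, and it forces the slopes of the second additions
  to be \<open>k - l - a1\<close> and \<open>k - m - a1\<close> with the same \<open>k = (u - v) / (l - m)\<close>. In these terms both sides of
  the associative law are visibly equal. The pair \<open>P1\<close>, \<open>P2\<close> may coincide; only \<open>P3\<close> has to be in
  general position.
\<close>

lemma point_add_assoc_chords:
  fixes E :: "'a::field_char_0 weierstrass"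
  assumes c: "on_curve E (Affine x1 y1)" "on_curve E (Affine x2 y2)" "on_curve E (Affine x3 y3)"
    and n12: "\<not> (x1 = x2 \<and> y1 + y2 + a1 E * x2 + a3 E = 0)"
    and P12: "point_add E (Affine x1 y1) (Affine x2 y2) = Affine u12 v12" and g12: "u12 \<noteq> x3"
    and P23: "point_add E (Affine x2 y2) (Affine x3 y3) = Affine u23 v23" and g23: "x1 \<noteq> u23"
    and g: "x1 \<noteq> x3" "x2 \<noteq> x3"
  shows "point_add E (point_add E (Affine x1 y1) (Affine x2 y2)) (Affine x3 y3)
       = point_add E (Affine x1 y1) (point_add E (Affine x2 y2) (Affine x3 y3))"
proof -
  obtain l where l: "is_slope E x1 y1 x2 y2 l" using slope_exists[OF c(1,2) n12] by blast
  have n23: "\<not> (x2 = x3 \<and> y2 + y3 + a1 E * x3 + a3 E = 0)" using g by blast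
  obtain m where m: "is_slope E x2 y2 x3 y3 m" using slope_exists[OF c(2,3) n23] by blast
  define u where "u = x1 - x2"
  define v where "v = x3 - x2"
  define t where "t = 2 * y2 + a1 E * x2 + a3 E"
  define k where "k = (u - v) / (l - m)"
  define L where "L = k - l - a1 E"
  define M where "M = k - m - a1 E"
  have uv: "u - v \<noteq> 0" using g by (simp add: u_def v_def)
  have u12: "u12 = l\<^sup>2 + a1 E * l - a2 E - x1 - x2" "v12 = - y1 - l * (u12 - x1) - a1 E * u12 - a3 E"
    using point_add_slope[OF c(1,2) n12 l refl] P12 by auto
  have u23: "u23 = m\<^sup>2 + a1 E * m - a2 E - x2 - x3" "v23 = - y2 - m * (u23 - x2) - a1 E * u23 - a3 E"
    using point_add_slope[OF c(2,3) n23 m refl] P23 by auto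
  have rel: "u * (x3 - u12) - v * (x1 - u23) = t * (l - m)"
    using l m unfolding is_slope_def u12 u23 u_def v_def t_def
    by (elim conjE) Groebner_Basis.algebra
  have dif: "(x3 - u12) - (x1 - u23) = (m + l + a1 E) * (m - l)"
    unfolding u12(1) u23(1) by Groebner_Basis.algebra
  \<comment> \<open>Equal slopes would mean collinear points, hence equal denominators, and then \<open>rel\<close> gives \<open>u = v\<close>.\<close>
  have lm: "l - m \<noteq> 0"
  proof
    assume "l - m = 0"
    with rel dif have "(u - v) * (x3 - u12) = 0" by Groebner_Basis.algebra
    with uv g12 show False by auto
  qed
  hence k: "k * (l - m) = u - v" by (simp add: k_def)
  have "(l - m) * (t + (l + m + a1 E) * v) = (l - m) * (k * (x3 - u12))"
    using k rel dif by Groebner_Basis.algebra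
  hence k1: "t + (l + m + a1 E) * v = k * (x3 - u12)" using lm by simp
  have "(l - m) * (t + (l + m + a1 E) * u) = (l - m) * (k * (x1 - u23))"
    using k rel dif by Groebner_Basis.algebra
  hence k2: "t + (l + m + a1 E) * u = k * (x1 - u23)" using lm by simp
  have c12: "on_curve E (Affine u12 v12)" and c23: "on_curve E (Affine u23 v23)"
    using on_curve_point_add[OF c(1,2)] on_curve_point_add[OF c(2,3)] P12 P23 by simp_all
  \<comment> \<open>For distinct \<open>x\<close>-coordinates the first slope equation suffices.\<close>
  have slope: "is_slope E x y x' y' s" 
    if "on_curve E (Affine x y)" "on_curve E (Affine x' y')" "x \<noteq> x'" "y - y' = s * (x - x')" for x y x' y' s
  proof -
    from slope_exists[OF that(1,2)] that(3) obtain s' where s': "is_slope E x y x' y' s'" by blast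
    with that(3,4) have "s = s'" by (auto simp: is_slope_def)
    with s' show ?thesis by simp
  qed
  have "v12 - y3 = L * (u12 - x3)"
    using k1 l m unfolding L_def is_slope_def t_def v_def u12(2)
    by (elim conjE) Groebner_Basis.algebra
  hence L: "is_slope E u12 v12 x3 y3 L" by (rule slope[OF c12 c(3) g12])
  have "y1 - v23 = M * (x1 - u23)"
    using k2 l m unfolding M_def is_slope_def t_def u_def u23(2)
    by (elim conjE) Groebner_Basis.algebra
  hence M: "is_slope E x1 y1 u23 v23 M" by (rule slope[OF c(1) c23 g23])
  have X: "L\<^sup>2 + a1 E * L - a2 E - u12 - x3 = M\<^sup>2 + a1 E * M - a2 E - x1 - u23"
    using k unfolding L_def M_def u12(1) u23(1) u_def v_def by Groebner_Basis.algebra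
  define w where "w = L\<^sup>2 + a1 E * L - a2 E - u12 - x3"
  have Y: "v12 + L * (w - u12) = y1 + M * (w - x1)"
    using k L l m unfolding w_def L_def M_def u12(1) u23(1) u_def v_def is_slope_def
    by (elim conjE) Groebner_Basis.algebra
  have n1: "\<not> (u12 = x3 \<and> v12 + y3 + a1 E * x3 + a3 E = 0)"
    and n2: "\<not> (x1 = u23 \<and> y1 + v23 + a1 E * u23 + a3 E = 0)" using g12 g23 by blast+
  show ?thesis unfolding P12 P23
    using point_add_slope[OF c12 c(3) n1 L w_def] point_add_slope[OF c(1) c23 n2 M, of w] X Y
    by (simp add: w_def algebra_simps)
qed

lemma same_x_points:
  assumes "on_curve E (Affine x y1)" "on_curve E (Affine x y2)"
  shows "Affine x y1 = Affine x y2 \<or> Affine x y1 = neg_point E (Affine x y2)"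
  using same_x_cases[OF assms] by (auto simp: eq_diff_eq eq_neg_iff_add_eq_0 add_ac)

text \<open>
  Excluded are infinity and the points for which \<open>S\<close>, or \<open>R + S\<close>, shares its \<open>x\<close>-coordinate with a
  point that it has to be added to; also \<open>S = U\<close> and \<open>S = -U\<close>, for which the relation behind the
  computation with slopes degenerates. The case \<open>U = -R\<close>, in which no line occurs, is cancellation.
\<close>

lemma point_add_assoc_cofinite:
  fixes E :: "'a::field_char_0 weierstrass"
  assumes U: "on_curve E U" and R: "on_curve E R" and disc: "discriminant E \<noteq> 0"
  shows "\<exists>B. finite B \<and> (\<forall>S. on_curve E S \<and> S \<notin> B \<longrightarrow>
    point_add E (point_add E U R) S = point_add E U (point_add E R S))"
proof (intro exI conjI allI impI)
  let ?B = "{Infinity, U, neg_point E U, R, neg_point E R, point_add E U R, neg_point E (point_add E U R),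
             point_add E U (neg_point E R), point_add E (neg_point E U) (neg_point E R)}"
  show "finite ?B" by simp
  fix S assume S': "on_curve E S \<and> S \<notin> ?B"
  hence S: "on_curve E S" and B: "S \<notin> ?B" by auto
  have sub: "point_add E (point_add E R S) (neg_point E R) = S"
    using point_add_neg_cancel[OF S R disc] point_add_commute[OF S R] by simp
  consider "U = Infinity \<or> R = Infinity" | "U = neg_point E R" "R \<noteq> Infinity" 
    | x1 y1 x2 y2 where "U = Affine x1 y1" "R = Affine x2 y2" "U \<noteq> neg_point E R"
    by (cases U; cases R) auto
  thus "point_add E (point_add E U R) S = point_add E U (point_add E R S)"
  proof cases
    case 1 thus ?thesis by auto
  next
    case 2 
    thus ?thesis using sub point_add_commute[of E "point_add E R S" U] on_curve_point_add[OF R S] U by simp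
  next
    case 3
    obtain x3 y3 where S3: "S = Affine x3 y3" using B by (cases S) auto
    have n12: "\<not> (x1 = x2 \<and> y1 + y2 + a1 E * x2 + a3 E = 0)"
      using 3 by (auto simp: eq_diff_eq eq_neg_iff_add_eq_0 add_ac)
    have x3: "x3 \<noteq> x" if "on_curve E (Affine x y)" "Affine x y \<in> {U, R, point_add E U R}" for x y
    proof
      assume "x3 = x"
      with same_x_points[of E x y3 y] that(1) S
      have "S = Affine x y \<or> S = neg_point E (Affine x y)" unfolding S3 by blast
      with that(2) B show False by (elim disjE) (auto simp del: neg_point.simps)
    qed
    obtain u12 v12 where P12: "point_add E U R = Affine u12 v12"
      using 3 n12 by (auto simp: Let_def)
    have "x1 \<noteq> x3" "x2 \<noteq> x3" "u12 \<noteq> x3"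
      using x3[of x1 y1] x3[of x2 y2] x3[of u12 v12] U R on_curve_point_add[OF U R] 3 P12 by auto
    moreover obtain u23 v23 where P23: "point_add E R S = Affine u23 v23"
      using \<open>x2 \<noteq> x3\<close> 3 S3 by (auto simp: Let_def)
    moreover have "x1 \<noteq> u23"
    proof
      assume "x1 = u23"
      hence "point_add E R S = U \<or> point_add E R S = neg_point E U"
        using same_x_points[of E u23 v23 y1] on_curve_point_add[OF R S] U P23 3 by auto
      thus False using sub B by auto
    qed
    ultimately show ?thesis
      using point_add_assoc_chords[OF U[unfolded 3(1)] R[unfolded 3(2)] S[unfolded S3] n12
          P12[unfolded 3(1,2)] _ P23[unfolded 3(2) S3]]
      unfolding 3(1,2) S3 by metis
  qed
qed

text \<open>
  Degenerate triples are moved into general position by adding an auxiliary point \<open>S\<close> that avoids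
  finitely many values:
  \<open>((P + Q) + R) + S = (P + Q) + (R + S) = P + (Q + (R + S)) = P + ((Q + R) + S) = (P + (Q + R)) + S\<close>,
  and \<open>S\<close> can be cancelled.
\<close>

theorem point_add_assoc:
  fixes E :: "'a::field_char_0 weierstrass"
  assumes P: "on_curve E P" and Q: "on_curve E Q" and R: "on_curve E R" and disc: "discriminant E \<noteq> 0"
    and inf: "infinite {S. on_curve E S}"
  shows "point_add E (point_add E P Q) R = point_add E P (point_add E Q R)"
proof -
  note cl = on_curve_point_add
  obtain B1 where B1: "finite B1" "\<And>S. on_curve E S \<Longrightarrow> S \<notin> B1 \<Longrightarrow>
      point_add E (point_add E (point_add E P Q) R) S = point_add E (point_add E P Q) (point_add E R S)"
    using point_add_assoc_cofinite[OF cl[OF P Q] R disc] by auto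
  obtain B2 where B2: "finite B2" "\<And>S. on_curve E S \<Longrightarrow> S \<notin> B2 \<Longrightarrow>
      point_add E (point_add E P Q) S = point_add E P (point_add E Q S)"
    using point_add_assoc_cofinite[OF P Q disc] by auto
  obtain B3 where B3: "finite B3" "\<And>S. on_curve E S \<Longrightarrow> S \<notin> B3 \<Longrightarrow>
      point_add E (point_add E Q R) S = point_add E Q (point_add E R S)"
    using point_add_assoc_cofinite[OF Q R disc] by auto
  obtain B4 where B4: "finite B4" "\<And>S. on_curve E S \<Longrightarrow> S \<notin> B4 \<Longrightarrow>
      point_add E (point_add E P (point_add E Q R)) S = point_add E P (point_add E (point_add E Q R) S)"
    using point_add_assoc_cofinite[OF P cl[OF Q R] disc] by auto
  have inj: "inj_on (point_add E R) {S. on_curve E S}"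
    using point_add_right_cancel[OF _ _ R disc] point_add_commute[OF R] by (auto intro!: inj_onI)
  \<comment> \<open>The second equation of the chain needs \<open>R + S\<close>, not \<open>S\<close>, to be in general position.\<close>
  have "finite (point_add E R -` B2 \<inter> {S. on_curve E S})"
    using finite_vimage_IntI[OF B2(1) inj] .
  with inf B1(1) B3(1) B4(1) obtain S where S: "on_curve E S"
      "S \<notin> B1" "S \<notin> B3" "S \<notin> B4" "S \<notin> point_add E R -` B2 \<inter> {S. on_curve E S}"
    using infinite_imp_nonempty[OF Diff_infinite_finite[OF _ inf,
        of "B1 \<union> B3 \<union> B4 \<union> (point_add E R -` B2 \<inter> {S. on_curve E S})"]]
    by blast
  have "point_add E (point_add E (point_add E P Q) R) S
      = point_add E (point_add E P (point_add E Q R)) S"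
    using B1(2)[of S] B2(2)[of "point_add E R S"] B3(2)[of S] B4(2)[of S] S cl[OF R S(1)] by auto
  thus ?thesis
    using point_add_right_cancel[OF cl[OF cl[OF P Q] R] cl[OF P cl[OF Q R]] S(1) disc] by blast
qed

lemma subfield_UNIV: "subfield UNIV (ring_of_type_algebra :: 'a::field ring)"
  by (simp add: subfield_of_type_iff)

lemma rational_over_UNIV [simp]: "rational_over UNIV P"
  by (cases P) auto

lemma rational_points_simps [simp]:
  "carrier (rational_points E F) = {P. on_curve E P \<and> rational_over F P}"
  "monoid.mult (rational_points E F) = point_add E" "one (rational_points E F) = Infinity"
  by (simp_all add: rational_points_def)

text \<open>
  Multiples of a point do not depend on the field over which they are taken, so torsion can be
  counted over the whole type.
\<close>

lemma pow_rational_points: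
  "P [^]\<^bsub>rational_points E F\<^esub> (n::nat) = P [^]\<^bsub>rational_points E UNIV\<^esub> n"
  by (induction n) auto

lemma rational_over_neg_point:
  fixes E :: "'a::field weierstrass"
  assumes "subfield F ring_of_type_algebra" "a1 E \<in> F" "a3 E \<in> F" "rational_over F P"
  shows "rational_over F (neg_point E P)"
  using assms by (cases P) (auto intro!: subfield_closed)

lemma rational_over_point_add:
  fixes E :: "'a::field weierstrass"
  assumes "subfield F ring_of_type_algebra" "a1 E \<in> F" "a2 E \<in> F" "a3 E \<in> F" "a4 E \<in> F"
    and "rational_over F P" "rational_over F Q"
  shows "rational_over F (point_add E P Q)"
  using assms by (cases P; cases Q) (auto simp: Let_def intro!: subfield_closed)

theorem comm_group_rational_points:
  fixes E :: "'a::field_char_0 weierstrass"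
  assumes "subfield F ring_of_type_algebra" "a1 E \<in> F" "a2 E \<in> F" "a3 E \<in> F" "a4 E \<in> F"
    and "discriminant E \<noteq> 0" and "infinite {P. on_curve E P}"
  shows "comm_group (rational_points E F)"
proof (rule comm_groupI)
  fix P assume P: "P \<in> carrier (rational_points E F)"
  thus "\<exists>Q\<in>carrier (rational_points E F). Q \<otimes>\<^bsub>rational_points E F\<^esub> P = \<one>\<^bsub>rational_points E F\<^esub>"
    using rational_over_neg_point[OF assms(1,2,4)] by (intro bexI[of _ "neg_point E P"]) auto
qed (use assms in \<open>auto simp: on_curve_point_add rational_over_point_add point_add_assoc intro: point_add_commute\<close>)


section \<open>Counting torsion points\<close>

text \<open>
  The pair \<open>(u : w)\<close> represents the \<open>x\<close>-coordinate projectively, with \<open>(1 : 0)\<close> at infinity. The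
  degenerate pair \<open>(0, 0)\<close> is admitted for every point: all that is used in the end is that \<open>w\<close>
  vanishes at infinity, and without this concession the recursion below would have to divide by
  common factors.
\<close>

fun x_ratio :: "'a::field point \<Rightarrow> 'a \<Rightarrow> 'a \<Rightarrow> bool" where
  "x_ratio Infinity u w = (w = 0)"
| "x_ratio (Affine x y) u w = (u = x * w)"

text \<open>
  The homogenised duplication formula. Its denominator is \<open>(2y + a1 x + a3)\<^sup>2\<close> expressed in \<open>x\<close>,
  so it vanishes at the points of order two.
\<close>

lemma x_ratio_double:
  fixes E :: "'a::field_char_0 weierstrass"
  assumes P: "on_curve E P" and r: "x_ratio P h k"
  shows "x_ratio (point_add E P P)
    (h * h * h * h - b4 E * (h * h * k * k) - 2 * b6 E * (h * k * k * k) - b8 E * (k * k * k * k))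
    (4 * (h * h * h * k) + b2 E * (h * h * k * k) + 2 * b4 E * (h * k * k * k) + b6 E * (k * k * k * k))"
proof (cases P)
  case Infinity thus ?thesis using r by simp
next
  case (Affine x y)
  hence c: "on_curve E (Affine x y)" and h: "h = x * k" using P r by auto
  have sq: "(2 * y + a1 E * x + a3 E)\<^sup>2 = 4 * x ^ 3 + b2 E * x\<^sup>2 + 2 * b4 E * x + b6 E"
    using c unfolding on_curve.simps b2_def b4_def b6_def by Groebner_Basis.algebra
  show ?thesis using c c
  proof (cases rule: affine_sum_cases)
    case 1
    hence "2 * y + a1 E * x + a3 E = 0" by simp
    thus ?thesis using sq unfolding Affine h point_add_inverse[OF 1] x_ratio.simps by Groebner_Basis.algebra
  next
    case (2 l)
    define u where "u = l\<^sup>2 + a1 E * l - a2 E - x - x"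
    have "u * (4 * x ^ 3 + b2 E * x\<^sup>2 + 2 * b4 E * x + b6 E) = x ^ 4 - b4 E * x\<^sup>2 - 2 * b6 E * x - b8 E"
      using 2(2) c u_def unfolding is_slope_def b2_def b4_def b6_def b8_def on_curve.simps
      by (elim conjE) Groebner_Basis.algebra
    thus ?thesis unfolding Affine h 2(3) x_ratio.simps u_def[symmetric] by Groebner_Basis.algebra
  qed
qed

text \<open>
  The sum \<open>P + Q\<close> and the difference \<open>P - Q\<close> both have \<open>x1 - x2\<close> in the denominator of their slope.
  Each \<open>x\<close>-coordinate involves \<open>y1\<close> and \<open>y2\<close>, but their product is invariant under
  changing the sign of either point and hence a function of \<open>x1\<close> and \<open>x2\<close>.
\<close>

lemma x_sum_times_x_difference:
  fixes E :: "'a::field_char_0 weierstrass"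
  assumes c: "on_curve E (Affine x1 y1)" "on_curve E (Affine x2 y2)" and ne: "x1 \<noteq> x2"
    and sum: "point_add E (Affine x1 y1) (Affine x2 y2) = Affine u v"
    and diff: "point_add E (Affine x1 y1) (neg_point E (Affine x2 y2)) = Affine u' v'"
  shows "u * u' * (x1 - x2)\<^sup>2 = x1\<^sup>2 * x2\<^sup>2 - b4 E * x1 * x2 - b6 E * (x1 + x2) - b8 E"
proof -
  define d where "d = x1 - x2"
  have d: "d \<noteq> 0" using ne by (simp add: d_def)
  have c2: "on_curve E (Affine x2 (- y2 - a1 E * x2 - a3 E))"
    using c(2) on_curve_neg_point[of E "Affine x2 y2"] unfolding neg_point.simps by blast
  have "u * d\<^sup>2 = (y1 - y2)\<^sup>2 + a1 E * (y1 - y2) * d - (a2 E + x1 + x2) * d\<^sup>2"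
    using c
  proof (cases rule: affine_sum_cases)
    case (2 l)
    hence "u = l\<^sup>2 + a1 E * l - a2 E - x1 - x2" using sum by simp
    with 2(2) show ?thesis unfolding is_slope_def d_def by (elim conjE) Groebner_Basis.algebra
  qed (use ne in auto)
  moreover have "u' * d\<^sup>2 = (y1 + y2 + a1 E * x2 + a3 E)\<^sup>2 + a1 E * (y1 + y2 + a1 E * x2 + a3 E) * d - (a2 E + x1 + x2) * d\<^sup>2"
    using c(1) c2
  proof (cases rule: affine_sum_cases)
    case (2 l)
    hence "u' = l\<^sup>2 + a1 E * l - a2 E - x1 - x2" using diff by simp
    with 2(2) show ?thesis unfolding is_slope_def d_def by (elim conjE) Groebner_Basis.algebra
  qed (use ne in auto)
  moreover have "((y1 - y2)\<^sup>2 + a1 E * (y1 - y2) * d - (a2 E + x1 + x2) * d\<^sup>2) *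
      ((y1 + y2 + a1 E * x2 + a3 E)\<^sup>2 + a1 E * (y1 + y2 + a1 E * x2 + a3 E) * d - (a2 E + x1 + x2) * d\<^sup>2)
      = (x1\<^sup>2 * x2\<^sup>2 - b4 E * x1 * x2 - b6 E * (x1 + x2) - b8 E) * d\<^sup>2"
    using c unfolding on_curve.simps d_def b4_def b6_def b8_def by Groebner_Basis.algebra
  ultimately have "(u * u' * d\<^sup>2) * d\<^sup>2 = (x1\<^sup>2 * x2\<^sup>2 - b4 E * x1 * x2 - b6 E * (x1 + x2) - b8 E) * d\<^sup>2"
    by Groebner_Basis.algebra
  thus ?thesis using d unfolding d_def by simp
qed

text \<open>
  Differential addition: if the \<open>x\<close>-coordinate of \<open>P - Q\<close> is known, that of \<open>P + Q\<close> depends on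
  \<open>x(P)\<close> and \<open>x(Q)\<close> alone. The factor \<open>x\<close> is moved to the denominator of the result.
\<close>

lemma x_ratio_add:
  fixes E :: "'a::field_char_0 weierstrass"
  assumes c: "on_curve E P" "on_curve E Q" and r: "x_ratio P h k" "x_ratio Q h' k'"
    and diff: "point_add E P (neg_point E Q) = Affine x y"
  shows "x_ratio (point_add E P Q)
    (h * h * h' * h' - b4 E * (h * h' * k * k') - b6 E * ((h * k' + h' * k) * k * k') - b8 E * (k * k * k' * k'))
    (x * ((h * k' - h' * k) * (h * k' - h' * k)))"
proof (cases P)
  case Infinity
  then obtain y' where "Q = Affine x y'" using diff by (cases Q) auto
  thus ?thesis using Infinity r by (simp add: mult_ac)
next
  case P: (Affine x1 y1)
  show ?thesis
  proof (cases Q)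
    case Infinity
    thus ?thesis using P r diff by (simp add: mult_ac)
  next
    case Q: (Affine x2 y2)
    have hk: "h = x1 * k" "h' = x2 * k'" using P Q r by auto
    show ?thesis
    proof (cases "point_add E P Q")
      case Infinity
      hence "x1 = x2" unfolding P Q by (auto simp: Let_def split: if_splits)
      thus ?thesis unfolding Infinity by (simp add: hk mult_ac)
    next
      case S: (Affine u v)
      have ne: "x1 \<noteq> x2"
      proof
        assume "x1 = x2"
        hence "P = Q \<or> P = neg_point E Q"
          using same_x_points[of E x1 y1 y2] c unfolding P Q by blast
        thus False using S diff by auto
      qed
      have "u * x * (x1 - x2)\<^sup>2 = x1\<^sup>2 * x2\<^sup>2 - b4 E * x1 * x2 - b6 E * (x1 + x2) - b8 E"
        using x_sum_times_x_difference[OF _ _ ne] c S diff unfolding P Q by blast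
      thus ?thesis unfolding S x_ratio.simps hk by Groebner_Basis.algebra
    qed
  qed
qed


text \<open>
  The coefficient \<open>c\<close> may be \<open>0\<close>, which makes the relation compatible with sums and products
  without case distinctions.
\<close>

definition leading :: "'a::comm_ring_1 poly \<Rightarrow> nat \<Rightarrow> 'a \<Rightarrow> bool" where
  "leading p n c \<longleftrightarrow> Polynomial.degree p \<le> n \<and> Polynomial.coeff p n = c"

lemma leading_mult:
  assumes "leading p m c" "leading q n d"
  shows "leading (p * q) (m + n) (c * d)"
proof -
  have deg: "Polynomial.degree p \<le> m" "Polynomial.degree q \<le> n" using assms by (auto simp: leading_def)
  have "Polynomial.coeff (p * q) (m + n) = (\<Sum>i\<le>m + n. Polynomial.coeff p i * Polynomial.coeff q (m + n - i))"
    by (rule coeff_mult)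
  also have "\<dots> = (\<Sum>i\<in>{m}. Polynomial.coeff p i * Polynomial.coeff q (m + n - i))"
  proof (rule sum.mono_neutral_right)
    show "\<forall>i\<in>{..m + n} - {m}. Polynomial.coeff p i * Polynomial.coeff q (m + n - i) = 0"
    proof
      fix i assume "i \<in> {..m + n} - {m}"
      hence "i > m \<or> m + n - i > n" by auto
      thus "Polynomial.coeff p i * Polynomial.coeff q (m + n - i) = 0"
        using deg coeff_eq_0[of p i] coeff_eq_0[of q "m + n - i"] by auto
    qed
  qed auto
  finally show ?thesis using assms deg degree_mult_le[of p q] by (auto simp: leading_def)
qed

lemma leading_add: "leading p n c \<Longrightarrow> leading q n d \<Longrightarrow> leading (p + q) n (c + d)"
  by (auto simp: leading_def degree_add_le)

lemma leading_diff: "leading p n c \<Longrightarrow> leading q n d \<Longrightarrow> leading (p - q) n (c - d)"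
  by (auto simp: leading_def degree_diff_le)

lemma leading_smult: "leading p n c \<Longrightarrow> leading (Polynomial.smult a p) n (a * c)"
  by (auto simp: leading_def intro: order.trans[OF degree_smult_le])

lemma leading_lower: "leading p m c \<Longrightarrow> m < n \<Longrightarrow> leading p n 0"
  by (auto simp: leading_def coeff_eq_0)

lemma leading_cong: "leading p m c \<Longrightarrow> m = n \<Longrightarrow> c = d \<Longrightarrow> leading p n d"
  by simp

text \<open>
  The pair \<open>p / q\<close> expresses \<open>x(nP)\<close> in terms of \<open>x(P)\<close>. It is built by \<open>2m = m + m\<close> and
  \<open>2m + 1 = (m + 1) + m\<close>, where \<open>(m + 1) P - m P = P\<close> has the known coordinate \<open>x\<close>. The reason behind the
  leading coefficients is that \<open>x(nP)\<close> behaves like \<open>x(P) / n\<^sup>2\<close> near infinity.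

  A denominator without spurious factors has degree \<open>n\<^sup>2 - 1\<close>. The odd step costs an additional
  factor \<open>x\<close>, and the degrees \<open>e\<close> follow the recursions \<open>e \<mapsto> 4e + 3\<close> and \<open>(e, f) \<mapsto> 2e + 2f + 3\<close>. The
  constant in \<open>2e + 3 \<le> 3n\<^sup>2\<close> is chosen so that the odd step preserves the inequality exactly.
\<close>

theorem torsion_polynomial:
  fixes E :: "'a::field_char_0 weierstrass"
  assumes G: "comm_group (rational_points E UNIV)" and n: "n > 0"
  shows "\<exists>p q e. leading p (Suc e) 1 \<and> leading q e (of_nat (n\<^sup>2)) \<and> 2 * e + 3 \<le> 3 * n\<^sup>2 \<and>
    (\<forall>x y. on_curve E (Affine x y) \<longrightarrow>
       x_ratio (Affine x y [^]\<^bsub>rational_points E UNIV\<^esub> n) (poly p x) (poly q x))"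
  using n
proof (induction n rule: less_induct)
  case (less n)
  define G where "G = rational_points E UNIV"
  interpret G: comm_group G using G by (simp add: G_def)
  have carrier: "P \<in> carrier G \<longleftrightarrow> on_curve E P" for P by (simp add: G_def)
  have mult: "P \<otimes>\<^bsub>G\<^esub> Q = point_add E P Q" for P Q by (simp add: G_def)
  consider "n = 1" | m where "n = 2 * m" "m > 0" | m where "n = 2 * m + 1" "m > 0"
    using less.prems by (metis One_nat_def add.commute add_cancel_right_left bot_nat_0.not_eq_extremum mult_0_right oddE evenE)
  thus ?case
  proof cases
    case 1
    have "x_ratio (Affine x y [^]\<^bsub>G\<^esub> n) (poly [:0, 1:] x) (poly 1 x)" if "on_curve E (Affine x y)" for x y
      using that 1 G.nat_pow_eone[of "Affine x y"] by (simp add: carrier)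
    moreover have "leading [:0, 1::'a:] (Suc 0) 1" "leading (1::'a poly) 0 (of_nat (n\<^sup>2))"
      using 1 by (simp_all add: leading_def)
    ultimately show ?thesis unfolding G_def using 1
      by (intro exI[of _ "[:0, 1:]"] exI[of _ 1] exI[of _ 0]) auto
  next
    case (2 m)
    then obtain p q e where IH: "leading p (Suc e) 1" "leading q e (of_nat (m\<^sup>2))" "2 * e + 3 \<le> 3 * m\<^sup>2"
      "\<And>x y. on_curve E (Affine x y) \<Longrightarrow> x_ratio (Affine x y [^]\<^bsub>G\<^esub> m) (poly p x) (poly q x)"
      using less.IH[of m] unfolding G_def by auto
    have q: "leading q (Suc e) 0" using leading_lower[OF IH(2)] by simp
    define p' where "p' = p * p * p * p - Polynomial.smult (b4 E) (p * p * q * q)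
      - Polynomial.smult (2 * b6 E) (p * q * q * q) - Polynomial.smult (b8 E) (q * q * q * q)"
    define q' where "q' = Polynomial.smult 4 (p * p * p * q) + Polynomial.smult (b2 E) (p * p * q * q)
      + Polynomial.smult (2 * b4 E) (p * q * q * q) + Polynomial.smult (b6 E) (q * q * q * q)"
    have "leading p' (Suc e + Suc e + Suc e + Suc e) (1 * 1 * 1 * 1 - b4 E * (1 * 1 * 0 * 0)
        - 2 * b6 E * (1 * 0 * 0 * 0) - b8 E * (0 * 0 * 0 * 0))"
      unfolding p'_def by (intro leading_diff leading_smult leading_mult IH q)
    moreover have "leading q' (Suc e + Suc e + Suc e + e) (4 * (1 * 1 * 1 * of_nat (m\<^sup>2)) + b2 E * (1 * 1 * 0 * of_nat (m\<^sup>2))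
        + 2 * b4 E * (1 * 0 * 0 * of_nat (m\<^sup>2)) + b6 E * (0 * 0 * 0 * of_nat (m\<^sup>2)))"
      unfolding q'_def by (intro leading_add leading_smult leading_mult IH q)
    moreover have "x_ratio (Affine x y [^]\<^bsub>G\<^esub> n) (poly p' x) (poly q' x)" if c: "on_curve E (Affine x y)" for x y
    proof -
      have "Affine x y [^]\<^bsub>G\<^esub> n = point_add E (Affine x y [^]\<^bsub>G\<^esub> m) (Affine x y [^]\<^bsub>G\<^esub> m)"
        using c G.nat_pow_mult[of "Affine x y" m m] by (simp add: carrier mult 2 mult_2)
      moreover have "on_curve E (Affine x y [^]\<^bsub>G\<^esub> m)" using c G.nat_pow_closed by (simp only: carrier[symmetric])
      ultimately show ?thesis
        using x_ratio_double[OF _ IH(4)[OF c]] by (simp add: p'_def q'_def)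
    qed
    ultimately show ?thesis unfolding G_def using IH(3) 2
      by (intro exI[of _ p'] exI[of _ q'] exI[of _ "4 * e + 3"]) (auto simp: power2_eq_square elim!: leading_cong)
  next
    case (3 m)
    obtain p q e where p: "leading p (Suc e) 1" "leading q e (of_nat (m\<^sup>2))" "2 * e + 3 \<le> 3 * m\<^sup>2"
      "\<And>x y. on_curve E (Affine x y) \<Longrightarrow> x_ratio (Affine x y [^]\<^bsub>G\<^esub> m) (poly p x) (poly q x)"
      using less.IH[of m] 3 unfolding G_def by auto
    obtain r s f where r: "leading r (Suc f) 1" "leading s f (of_nat ((m + 1)\<^sup>2))" "2 * f + 3 \<le> 3 * (m + 1)\<^sup>2"
      "\<And>x y. on_curve E (Affine x y) \<Longrightarrow> x_ratio (Affine x y [^]\<^bsub>G\<^esub> (m + 1)) (poly r x) (poly s x)"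
      using less.IH[of "m + 1"] 3 unfolding G_def by auto
    have q: "leading q (Suc e) 0" and s: "leading s (Suc f) 0"
      using leading_lower[OF p(2)] leading_lower[OF r(2)] by simp_all
    define p' where "p' = p * p * r * r - Polynomial.smult (b4 E) (p * r * q * s)
      - Polynomial.smult (b6 E) ((r * q + p * s) * s * q) - Polynomial.smult (b8 E) (s * s * q * q)"
    define q' where "q' = [:0, 1:] * ((r * q - p * s) * (r * q - p * s))"
    \<comment> \<open>In \<open>p'\<close> only the first product reaches the top degree; each of the others contains at least two denominators.\<close>
    have 1: "leading (p * p * r * r) (Suc e + Suc e + Suc f + Suc f) (1 * 1 * 1 * 1)"
      by (intro leading_mult p r)
    have "leading (p * r * q * s) (Suc e + Suc f + Suc e + Suc f) (1 * 1 * 0 * 0)"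
      by (intro leading_mult p r q s)
    hence 2: "leading (p * r * q * s) (Suc e + Suc e + Suc f + Suc f) 0"
      by (rule leading_cong) auto
    have rq0: "leading (r * q) (Suc e + Suc f) 0"
      using leading_mult[OF r(1) q] by (rule leading_cong) auto
    have ps0: "leading (p * s) (Suc e + Suc f) 0"
      using leading_mult[OF p(1) s] by (rule leading_cong) auto
    have "leading ((r * q + p * s) * s * q) ((Suc e + Suc f) + Suc f + Suc e) ((0 + 0) * 0 * 0)"
      by (intro leading_mult leading_add rq0 ps0 q s)
    hence lower3: "leading ((r * q + p * s) * s * q) (Suc e + Suc e + Suc f + Suc f) 0"
      by (rule leading_cong) auto
    have "leading (s * s * q * q) (Suc f + Suc f + Suc e + Suc e) (0 * 0 * 0 * 0)"
      by (intro leading_mult p r q s)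
    hence 4: "leading (s * s * q * q) (Suc e + Suc e + Suc f + Suc f) 0"
      by (rule leading_cong) auto
    have "leading p' (Suc e + Suc e + Suc f + Suc f) (1 * 1 * 1 * 1 - b4 E * 0 - b6 E * 0 - b8 E * 0)"
      unfolding p'_def by (intro leading_diff leading_smult 1 2 lower3 4)
    moreover
    \<comment> \<open>The leading coefficient is \<open>m\<^sup>2 - (m + 1)\<^sup>2 = - (2 m + 1)\<close>, whose square is \<open>n\<^sup>2\<close>.\<close>
    have rq: "leading (r * q - p * s) (Suc e + f) (of_nat (m\<^sup>2) - of_nat ((m + 1)\<^sup>2))"
    proof (rule leading_diff)
      show "leading (r * q) (Suc e + f) (of_nat (m\<^sup>2))"
        using leading_mult[OF r(1) p(2)] by (rule leading_cong) auto
      show "leading (p * s) (Suc e + f) (of_nat ((m + 1)\<^sup>2))"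
        using leading_mult[OF p(1) r(2)] by (rule leading_cong) auto
    qed
    have "leading [:0, 1::'a:] 1 1" by (simp add: leading_def)
    hence "leading q' (1 + ((Suc e + f) + (Suc e + f)))
        (1 * ((of_nat (m\<^sup>2) - of_nat ((m + 1)\<^sup>2)) * (of_nat (m\<^sup>2) - of_nat ((m + 1)\<^sup>2))))"
      unfolding q'_def by (intro leading_mult rq)
    moreover have "x_ratio (Affine x y [^]\<^bsub>G\<^esub> n) (poly p' x) (poly q' x)" if c: "on_curve E (Affine x y)" for x y
    proof -
      let ?P = "Affine x y"
      have cl: "?P \<in> carrier G" "on_curve E (?P [^]\<^bsub>G\<^esub> k)" for k :: nat
        using c G.nat_pow_closed[of ?P k] by (simp_all only: carrier)
      have sum: "?P [^]\<^bsub>G\<^esub> n = point_add E (?P [^]\<^bsub>G\<^esub> (m + 1)) (?P [^]\<^bsub>G\<^esub> m)"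
        using cl G.nat_pow_mult[of ?P "m + 1" m] by (simp only: mult 3) (simp add: mult_2)
      have inv: "inv\<^bsub>G\<^esub> Q = neg_point E Q" if "on_curve E Q" for Q
        using that G.inv_equality[of "neg_point E Q" Q] by (simp add: G_def)
      have "?P [^]\<^bsub>G\<^esub> (m + 1) \<otimes>\<^bsub>G\<^esub> inv\<^bsub>G\<^esub> (?P [^]\<^bsub>G\<^esub> m) = ?P"
        using cl(1) G.nat_pow_Suc2[of ?P m] by (simp add: G.m_assoc)
      hence "point_add E (?P [^]\<^bsub>G\<^esub> (m + 1)) (neg_point E (?P [^]\<^bsub>G\<^esub> m)) = Affine x y"
        by (simp only: inv[OF cl(2)] mult)
      from x_ratio_add[OF cl(2) cl(2) r(4)[OF c] p(4)[OF c] this]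
      show ?thesis unfolding sum by (simp add: p'_def q'_def mult_ac)
    qed
    moreover have "2 * (2 * e + 2 * f + 3) + 3 \<le> 3 * n\<^sup>2"
      using p(3) r(3) by (simp add: 3(1) power2_eq_square)
    moreover have "(of_nat (m\<^sup>2) - of_nat ((m + 1)\<^sup>2)) * (of_nat (m\<^sup>2) - of_nat ((m + 1)\<^sup>2)) = (of_nat (n\<^sup>2) :: 'a)"
      by (simp add: 3(1) power2_eq_square algebra_simps)
    ultimately show ?thesis unfolding G_def
      by (intro exI[of _ p'] exI[of _ q'] exI[of _ "2 * e + 2 * f + 3"]) (auto elim!: leading_cong)
  qed
qed

text \<open>
  Every root of the denominator is the \<open>x\<close>-coordinate of at most two points, and the point at
  infinity is counted separately.
\<close>

theorem card_torsion_le: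
  fixes E :: "'a::field_char_0 weierstrass"
  assumes G: "comm_group (rational_points E UNIV)" and n: "n > 0"
  shows "finite {P. on_curve E P \<and> P [^]\<^bsub>rational_points E UNIV\<^esub> n = Infinity}"
    and "card {P. on_curve E P \<and> P [^]\<^bsub>rational_points E UNIV\<^esub> n = Infinity} \<le> 3 * n\<^sup>2 - 2"
proof -
  obtain p q e where q: "leading q e (of_nat (n\<^sup>2) :: 'a)" and e: "2 * e + 3 \<le> 3 * n\<^sup>2" and
    r: "\<And>x y. on_curve E (Affine x y) \<Longrightarrow> x_ratio (Affine x y [^]\<^bsub>rational_points E UNIV\<^esub> n) (poly p x) (poly q x)"
    using torsion_polynomial[OF G n] by blast
  have "q \<noteq> 0" using q n by (auto simp: leading_def)
  hence roots: "finite {x. poly q x = 0}" "card {x. poly q x = 0} \<le> e"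
    using poly_roots_finite card_poly_roots_bound[of q] q by (auto simp: leading_def)
  define S where "S = (\<lambda>x. {Q. \<exists>y. Q = Affine x y \<and> on_curve E Q})"
  have S: "finite (S x) \<and> card (S x) \<le> 2" for x
  proof (cases "S x = {}")
    case False
    then obtain y where y: "on_curve E (Affine x y)" by (auto simp: S_def)
    have "S x \<subseteq> {Affine x y, neg_point E (Affine x y)}"
      using same_x_points[of E x _ y] y unfolding S_def by blast
    thus ?thesis using card_mono[of "{Affine x y, neg_point E (Affine x y)}" "S x"]
      by (auto intro: finite_subset order.trans simp: card_insert_if split: if_splits)
  qed auto
  let ?T = "{P. on_curve E P \<and> P [^]\<^bsub>rational_points E UNIV\<^esub> n = Infinity}"
  let ?U = "insert Infinity (\<Union>x\<in>{x. poly q x = 0}. S x)"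
  have sub: "?T \<subseteq> ?U"
  proof
    fix P assume P: "P \<in> ?T"
    show "P \<in> ?U"
    proof (cases P)
      case (Affine x y)
      with P r[of x y] show ?thesis by (auto simp: S_def)
    qed simp
  qed
  have fin: "finite ?U" using roots S by auto
  thus "finite ?T" using sub finite_subset by blast
  have "card (\<Union>x\<in>{x. poly q x = 0}. S x) \<le> (\<Sum>x\<in>{x. poly q x = 0}. card (S x))"
    by (rule card_UN_le[OF roots(1)])
  also have "\<dots> \<le> (\<Sum>x\<in>{x. poly q x = 0}. 2)" using S by (intro sum_mono) auto
  also have "\<dots> \<le> 2 * e" using roots by simp
  finally have "card ?U \<le> 2 * e + 1" using card_insert_le_m1 fin by (simp add: card_insert_if)
  thus "card ?T \<le> 3 * n\<^sup>2 - 2" using card_mono[OF fin sub] e by linarith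
qed

text \<open>
  For \<open>n = 2\<close> the general bound \<open>10\<close> is too weak, but a point of order two is determined by its
  \<open>x\<close>-coordinate, which is a root of a cubic.
\<close>

lemma card_two_torsion_le:
  fixes E :: "'a::field_char_0 weierstrass"
  shows "finite {P. on_curve E P \<and> point_add E P P = Infinity}"
    and "card {P. on_curve E P \<and> point_add E P P = Infinity} \<le> 4"
proof -
  let ?q = "[:b6 E, 2 * b4 E, b2 E, 4:]"
  have roots: "finite {x. poly ?q x = 0}" "card {x. poly ?q x = 0} \<le> 3"
    using poly_roots_finite[of ?q] card_poly_roots_bound[of ?q] by auto
  let ?T = "{P. on_curve E P \<and> point_add E P P = Infinity}"
  let ?U = "insert Infinity ((\<lambda>x. Affine x (- (a1 E * x + a3 E) / 2)) ` {x. poly ?q x = 0})"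
  have sub: "?T \<subseteq> ?U"
  proof
    fix P assume P: "P \<in> ?T"
    show "P \<in> ?U"
    proof (cases P)
      case (Affine x y)
      with P have c: "on_curve E (Affine x y)" and t: "2 * y + a1 E * x + a3 E = 0"
        by (auto simp: Let_def split: if_splits)
      have "4 * x ^ 3 + b2 E * x\<^sup>2 + 2 * b4 E * x + b6 E = (2 * y + a1 E * x + a3 E)\<^sup>2"
        using c unfolding on_curve.simps b2_def b4_def b6_def by Groebner_Basis.algebra
      also have "\<dots> = 0" using t by simp
      finally have "poly ?q x = 0" by (simp add: algebra_simps power2_eq_square power3_eq_cube)
      moreover have "y = - (a1 E * x + a3 E) / 2" using t by (simp add: field_simps eq_neg_iff_add_eq_0)
      ultimately show ?thesis using Affine by auto
    qed simp
  qed
  have fin: "finite ?U" using roots by auto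
  thus "finite ?T" using sub finite_subset by blast
  have "card (insert R A) \<le> Suc (card A)" if "finite A" for R and A :: "'a point set"
    using that by (simp add: card_insert_if)
  from this[OF finite_imageI[OF roots(1)]]
  have "card ?U \<le> Suc (card ((\<lambda>x. Affine x (- (a1 E * x + a3 E) / 2)) ` {x. poly ?q x = 0}))" .
  also have "\<dots> \<le> Suc (card {x. poly ?q x = 0})" using card_image_le[OF roots(1)] by (rule Suc_le_mono[THEN iffD2])
  finally show "card ?T \<le> 4" using card_mono[OF fin sub] roots(2) by linarith
qed

section \<open>Symmetric groups acting on abelian groups with few torsion elements\<close>

text \<open>
  Applying \<open>1 + h\<close> annihilates the eigenvectors for \<open>-1\<close> and doubles the one for \<open>1\<close>.
\<close>

lemma (in comm_group) eigenvector_part: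
  assumes h: "h \<in> hom G G" and c: "a \<in> carrier G" "b \<in> carrier G" "c \<in> carrier G"
    and e: "h a = a" "h b = inv b" "h c = inv c"
  shows "(a [^] (i::nat) \<otimes> b [^] (j::nat) \<otimes> c [^] (k::nat))
       \<otimes> h (a [^] i \<otimes> b [^] j \<otimes> c [^] k) = a [^] (2 * i)"
proof -
  interpret h: group_hom G G h using h by unfold_locales
  have "h (a [^] i \<otimes> b [^] j \<otimes> c [^] k) = a [^] i \<otimes> inv (b [^] j) \<otimes> inv (c [^] k)"
    using c by (simp add: h.hom_nat_pow e nat_pow_inv)
  moreover have "(a [^] i \<otimes> b [^] j \<otimes> c [^] k) \<otimes> (a [^] i \<otimes> inv (b [^] j) \<otimes> inv (c [^] k))
      = (a [^] i \<otimes> a [^] i) \<otimes> (b [^] j \<otimes> inv (b [^] j)) \<otimes> (c [^] k \<otimes> inv (c [^] k))"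
    using c by (simp add: m_ac)
  ultimately show ?thesis using c by (simp add: nat_pow_mult mult_2)
qed

text \<open>
  The three elements are eigenvectors of the Klein four group generated by \<open>s\<close> and \<open>t\<close> for its
  three nontrivial characters. Each of \<open>s\<close>, \<open>t\<close> and \<open>s \<circ> t\<close> fixes exactly one of them, so that
  \<open>eigenvector_part\<close> recovers twice each exponent from a product of powers; since \<open>e\<close> is odd, it
  recovers the exponents modulo \<open>e\<close>.
\<close>

lemma (in comm_group) card_torsion_ge_cube:
  assumes s: "s \<in> hom G G" and t: "t \<in> hom G G"
    and c: "u \<in> carrier G" "v \<in> carrier G" "w \<in> carrier G"
    and su: "s u = u" "s v = inv v" "s w = inv w"
    and tu: "t u = inv u" "t v = v" "t w = inv w"
    and o: "ord u = e" "ord v = e" "ord w = e" and "odd e"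
    and fin: "finite {x \<in> carrier G. x [^] e = \<one>}"
  shows "e ^ 3 \<le> card {x \<in> carrier G. x [^] e = \<one>}"
proof -
  define f where "f = (\<lambda>(i::nat, j::nat, k::nat). u [^] i \<otimes> v [^] j \<otimes> w [^] k)"
  interpret s: group_hom G G s using s by unfold_locales
  interpret t: group_hom G G t using t by unfold_locales
  have st: "s \<circ> t \<in> hom G G" using Group.hom_compose[OF t s] .
  have stw: "(s \<circ> t) w = w" "(s \<circ> t) u = inv u" "(s \<circ> t) v = inv v" using c su tu by auto
  have dbl: "i = j" if "x \<in> carrier G" "ord x = e" "x [^] (2 * i) = x [^] (2 * j)" "i < e" "j < e" for x and i j :: nat
  proof -
    have "x [^] int (2 * i) = x [^] int (2 * j)" using that(3) unfolding int_pow_int .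
    hence "int e dvd 2 * (int j - int i)"
      using that(1,2) int_pow_eq[of x "int (2 * i)" "int (2 * j)"] by (simp add: right_diff_distrib)
    moreover have "coprime (int e) 2" using \<open>odd e\<close> by simp
    ultimately have "int e dvd int j - int i" by (simp only: coprime_dvd_mult_right_iff)
    hence "int j mod int e = int i mod int e" by (simp add: mod_eq_dvd_iff)
    thus ?thesis using that(4,5) by simp
  qed
  have "inj_on f ({..<e} \<times> {..<e} \<times> {..<e})"
  proof (rule inj_onI, clarsimp)
    fix i j k i' j' k' assume lt: "i < e" "j < e" "k < e" "i' < e" "j' < e" "k' < e"
      and eq: "f (i, j, k) = f (i', j', k')"
    have 1: "f (i, j, k) \<otimes> s (f (i, j, k)) = u [^] (2 * i)" for i j k
      using eigenvector_part[OF s c su] by (simp add: f_def)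
    have f2: "f (i, j, k) = v [^] j \<otimes> u [^] i \<otimes> w [^] k" for i j k
      using c by (simp add: f_def m_ac)
    have 2: "f (i, j, k) \<otimes> t (f (i, j, k)) = v [^] (2 * j)" for i j k
      unfolding f2 using eigenvector_part[OF t c(2,1,3) tu(2,1,3)] by simp
    have f3: "f (i, j, k) = w [^] k \<otimes> u [^] i \<otimes> v [^] j" for i j k
      using c by (simp add: f_def m_ac)
    have 3: "f (i, j, k) \<otimes> (s \<circ> t) (f (i, j, k)) = w [^] (2 * k)" for i j k
      unfolding f3 using eigenvector_part[OF st c(3,1,2) stw] by simp
    show "i = i' \<and> j = j' \<and> k = k'"
      using dbl[OF c(1) o(1), of i i'] dbl[OF c(2) o(2), of j j'] dbl[OF c(3) o(3), of k k'] lt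
        1[of i j k] 1[of i' j' k'] 2[of i j k] 2[of i' j' k'] 3[of i j k] 3[of i' j' k'] eq by metis
  qed
  moreover have "f ` ({..<e} \<times> {..<e} \<times> {..<e}) \<subseteq> {x \<in> carrier G. x [^] e = \<one>}"
  proof clarsimp
    fix i j k 
    have "(x [^] (i::nat)) [^] e = \<one>" if "x \<in> carrier G" "ord x = e" for x i
      using that pow_eq_id[of x "i * e"] by (simp add: nat_pow_pow)
    thus "f (i, j, k) \<in> carrier G \<and> f (i, j, k) [^] e = \<one>"
      using c o by (simp add: f_def nat_pow_distrib)
  qed
  ultimately have "card ({..<e} \<times> {..<e} \<times> {..<e}) \<le> card {x \<in> carrier G. x [^] e = \<one>}"
    using card_inj_on_le fin by blast
  thus ?thesis by (simp add: card_cartesian_product power3_eq_cube mult.assoc)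
qed

locale symmetric_group_action = comm_group G for G (structure) +
  fixes I :: "'i set" and act :: "('i \<Rightarrow> 'i) \<Rightarrow> 'a \<Rightarrow> 'a"
  assumes act_hom: "p permutes I \<Longrightarrow> act p \<in> hom G G"
    and act_id: "x \<in> carrier G \<Longrightarrow> act id x = x"
    and act_comp: "p permutes I \<Longrightarrow> q permutes I \<Longrightarrow> x \<in> carrier G \<Longrightarrow> act (p \<circ> q) x = act p (act q x)"
begin

lemma act_closed [simp]: "p permutes I \<Longrightarrow> x \<in> carrier G \<Longrightarrow> act p x \<in> carrier G"
  using act_hom by (auto simp: hom_def)

lemma act_mult: "p permutes I \<Longrightarrow> x \<in> carrier G \<Longrightarrow> y \<in> carrier G \<Longrightarrow> act p (x \<otimes> y) = act p x \<otimes> act p y"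
  using act_hom by (auto simp: hom_def)

lemma act_group_hom: "p permutes I \<Longrightarrow> group_hom G G (act p)"
  using act_hom by unfold_locales

lemma act_inv: "p permutes I \<Longrightarrow> x \<in> carrier G \<Longrightarrow> act p (inv x) = inv (act p x)"
  using group_hom.hom_inv[OF act_group_hom] .

lemma act_pow: "p permutes I \<Longrightarrow> x \<in> carrier G \<Longrightarrow> act p (x [^] (n::nat)) = act p x [^] n"
  using group_hom.hom_nat_pow[OF act_group_hom] .

lemma act_one: "p permutes I \<Longrightarrow> act p \<one> = \<one>"
  using group_hom.hom_one[OF act_group_hom] .

lemma act_inj: "p permutes I \<Longrightarrow> x \<in> carrier G \<Longrightarrow> y \<in> carrier G \<Longrightarrow> act p x = act p y \<Longrightarrow> x = y"
  using act_comp[of "Hilbert_Choice.inv p" p] act_id permutes_inv permutes_inv_o(2) by metis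

lemma ord_act:
  assumes "p permutes I" "x \<in> carrier G"
  shows "ord (act p x) = ord x"
proof -
  have "act p x [^] n = \<one> \<longleftrightarrow> ord x dvd n" for n :: nat
    using act_inj[OF assms(1), of "x [^] n" \<one>] assms
    by (auto simp flip: act_pow simp: act_one simp flip: pow_eq_id)
  thus ?thesis using ord_unique[of "act p x" "ord x"] assms by simp
qed

text \<open>
  Conjugation by \<open>g\<close> maps \<open>s\<close> to \<open>t\<close> and \<open>t\<close> to \<open>s \<circ> t\<close>, so \<open>g\<close> rotates the eigenspaces of
  \<open>(s, t)\<close> for \<open>(+,-)\<close>, \<open>(-,+)\<close> and \<open>(-,-)\<close>. By the count of torsion elements all three are trivial. As
  \<open>2\<close> is invertible on odd torsion, only the eigenspace \<open>(+,+)\<close> remains.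
\<close>

lemma klein_four_fixes_odd_torsion:
  assumes perm: "s permutes I" "t permutes I" "g permutes I"
    and sq: "s \<circ> s = id" "t \<circ> t = id" "s \<circ> t = t \<circ> s"
    and conj: "t \<circ> g = g \<circ> s" "s \<circ> t \<circ> g = g \<circ> t"
    and few: "\<And>e. odd e \<Longrightarrow> e \<ge> 3 \<Longrightarrow> 
        finite {x \<in> carrier G. x [^] e = \<one>} \<and> card {x \<in> carrier G. x [^] e = \<one>} < e ^ 3"
    and x: "x \<in> carrier G" "x [^] d = \<one>" and d: "odd (d::nat)"
  shows "act s x = x"
proof -
  have tg: "act t (act g y) = act g (act s y)" if "y \<in> carrier G" for y
    using that conj(1) perm by (metis act_comp)
  have stg: "act s (act t (act g y)) = act g (act t y)" if "y \<in> carrier G" for y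
    using that conj(2) perm act_comp[of "s \<circ> t" g y] act_comp[of s t "act g y"] act_comp[of g t y]
    by (simp add: permutes_compose)
  have ss: "act s (act s y) = y" and tt: "act t (act t y) = y" and st: "act s (act t y) = act t (act s y)"
    if "y \<in> carrier G" for y
    using that sq perm act_comp[of s s y] act_comp[of t t y] act_comp[of s t y] act_comp[of t s y] act_id[of y] by auto
  have plus_minus: "u = \<one>" if u: "u \<in> carrier G" "act s u = u" "act t u = inv u" "u [^] d = \<one>" for u
  proof (rule ccontr)
    assume "u \<noteq> \<one>"
    define e v w where "e = ord u" and "v = act g u" and "w = act g v"
    have vw: "v \<in> carrier G" "w \<in> carrier G" "ord v = e" "ord w = e"
      using u perm by (simp_all add: v_def w_def e_def ord_act)
    have "e dvd d" using u pow_eq_id by (simp add: e_def)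
    hence e: "odd e" using d by auto
    moreover have "e \<noteq> 1" using \<open>u \<noteq> \<one>\<close> u ord_eq_1[of u] unfolding e_def by blast
    ultimately have "e \<ge> 3" by (metis One_nat_def Suc_1 Suc_leI even_zero less_one linorder_neqE_nat not_less_eq numeral_3_eq_3 even_numeral)
    have v: "act t v = v" "act s v = inv v"
      using tg[of u] stg[of u] u perm by (auto simp: v_def act_inv)
    have w: "act t w = inv w"
      using tg[of v] vw v perm by (simp add: w_def act_inv)
    have "inv (act s w) = w"
      using stg[of v] vw v w perm by (simp add: w_def act_inv)
    hence "act s w = inv w" using inv_inv vw perm by (metis act_closed)
    with v w u have "e ^ 3 \<le> card {x \<in> carrier G. x [^] e = \<one>}"
      using card_torsion_ge_cube[OF act_hom act_hom, of s t u v w e] perm vw few[OF e \<open>e \<ge> 3\<close>] e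
      by (simp add: e_def)
    with few[OF e \<open>e \<ge> 3\<close>] show False by simp
  qed
  have minus_minus: "u = \<one>" if u: "u \<in> carrier G" "act s u = inv u" "act t u = inv u" "u [^] d = \<one>" for u
  proof -
    have 1: "act t (act g u) = inv (act g u)" using tg[of u] u perm by (simp add: act_inv)
    have "inv (act s (act g u)) = inv (act g u)" using stg[of u] 1 u perm by (simp add: act_inv)
    hence "act s (act g u) = act g u" using u perm by (metis inv_inv act_closed)
    hence "act g u = \<one>" using plus_minus[of "act g u"] 1 u perm by (simp flip: act_pow add: act_one)
    thus ?thesis using act_inj[of g u \<one>] u perm by (simp add: act_one)
  qed
  have minus_plus: "u = \<one>" if u: "u \<in> carrier G" "act s u = inv u" "act t u = u" "u [^] d = \<one>" for u
  proof -
    have 1: "act t (act g u) = inv (act g u)" using tg[of u] u perm by (simp add: act_inv)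
    have "inv (act s (act g u)) = act g u" using stg[of u] 1 u perm by (simp add: act_inv)
    hence "act s (act g u) = inv (act g u)" using u perm by (metis inv_inv act_closed)
    hence "act g u = \<one>" using minus_minus[of "act g u"] 1 u perm by (simp flip: act_pow add: act_one)
    thus ?thesis using act_inj[of g u \<one>] u perm by (simp add: act_one)
  qed
  \<comment> \<open>The element \<open>y\<close> is in the \<open>-1\<close> eigenspace of \<open>s\<close>; its components \<open>(1 + t) y\<close> and \<open>(1 - t) y\<close> vanish, and so does their sum \<open>2 y\<close>.\<close>
  define y where "y = x \<otimes> inv (act s x)"
  have "act s x [^] d = \<one>" using x perm by (simp add: act_pow[symmetric] act_one)
  hence y: "y \<in> carrier G" "act s y = inv y" "y [^] d = \<one>"
    using x perm ss by (simp_all add: y_def act_mult act_inv inv_mult_group nat_pow_distrib nat_pow_inv)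
  have ty: "act t y \<in> carrier G" "act s (act t y) = inv (act t y)" "act t y [^] d = \<one>"
    using y perm st by (simp_all add: act_inv act_pow[symmetric] act_one)
  have "y \<otimes> act t y = \<one>"
  proof (rule minus_plus)
    show "act t (y \<otimes> act t y) = y \<otimes> act t y"
      using y ty perm tt m_comm by (simp add: act_mult)
  qed (use y ty perm in \<open>simp_all add: act_mult inv_mult nat_pow_distrib\<close>)
  moreover have "y \<otimes> inv (act t y) = \<one>"
  proof (rule minus_minus)
    show "act t (y \<otimes> inv (act t y)) = inv (y \<otimes> inv (act t y))"
      using y ty perm tt by (simp add: act_mult act_inv inv_mult_group)
  qed (use y ty perm in \<open>simp_all add: act_mult act_inv inv_mult nat_pow_distrib nat_pow_inv\<close>)
  ultimately have "y [^] (2::nat) = \<one>"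
    using y ty by (metis inv_solve_right' l_one m_comm nat_pow_0 nat_pow_Suc numeral_2_eq_2 one_closed inv_closed)
  hence "ord y dvd 2" "ord y dvd d" using y pow_eq_id by auto
  hence "ord y = 1" using d by (metis One_nat_def coprime_iff_gcd_eq_1 coprime_left_2_iff_odd gcd_greatest_iff nat_dvd_1_iff_1)
  hence "y = \<one>" using y ord_eq_1 by auto
  thus ?thesis using x perm unfolding y_def
    by (metis act_closed inv_closed inv_equality inv_inv)
qed

text \<open>
  An orbit of \<open>g\<close> has one or five elements, while there are at most three elements of order two.
  If \<open>g\<close> fixes \<open>2x\<close>, then \<open>r = g x - x\<close> is killed by \<open>2\<close> and therefore fixed, and
  \<open>x = g\<^sup>5 x = x + 5 r = x + r\<close> shows \<open>r = 0\<close>.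
\<close>

lemma five_cycle_fixes_two_power_torsion:
  assumes g: "g permutes I" "g \<circ> g \<circ> g \<circ> g \<circ> g = id"
    and few: "finite {x \<in> carrier G. x [^] (2::nat) = \<one>}" "card {x \<in> carrier G. x [^] (2::nat) = \<one>} \<le> 4"
  shows "x \<in> carrier G \<Longrightarrow> x [^] ((2::nat) ^ k) = \<one> \<Longrightarrow> act g x = x"
proof (induction k arbitrary: x)
  case 0 thus ?case using g by (simp add: act_one)
next
  case (Suc k)
  have five: "act g (act g (act g (act g (act g y)))) = y" if "y \<in> carrier G" for y
  proof -
    have "act (g \<circ> g \<circ> g \<circ> g \<circ> g) y = act g (act g (act g (act g (act g y))))"
      using that g(1) by (simp add: act_comp permutes_compose)
    thus ?thesis using g that by (simp add: act_id)
  qed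
  have two: "act g r = r" if r: "r \<in> carrier G" "r [^] (2::nat) = \<one>" for r
  proof (cases "r = \<one>")
    case True thus ?thesis using g by (simp add: act_one)
  next
    case False
    \<comment> \<open>Among the four elements \<open>r, g r, g\<^sup>2 r, g\<^sup>3 r\<close> two agree, so some power \<open>g\<^sup>i\<close> with \<open>0 < i < 5\<close> fixes \<open>r\<close>.\<close>
    let ?T = "{x \<in> carrier G. x [^] (2::nat) = \<one>} - {\<one>}"
    have T: "act g y \<in> ?T" if "y \<in> ?T" for y
      using that g act_inj[of g y \<one>] by (auto simp flip: act_pow simp: act_one)
    have cT: "card ?T \<le> 3" using few by (simp add: card_Diff_subset)
    have "{r, act g r, act g (act g r), act g (act g (act g r))} \<subseteq> ?T" (is "?R \<subseteq> _")
      using T r False by simp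
    hence cR: "card ?R \<le> 3" using cT few(1) card_mono[of ?T ?R] by simp
    have "\<not> distinct [r, act g r, act g (act g r), act g (act g (act g r))]"
    proof
      assume "distinct [r, act g r, act g (act g r), act g (act g (act g r))]"
      from distinct_card[OF this] have "card ?R = 4" by simp
      with cR show False by linarith
    qed
    moreover have inj: "act g y = act g z \<longleftrightarrow> y = z" if "y \<in> carrier G" "z \<in> carrier G" for y z
      using act_inj[OF g(1) that] by blast
    ultimately have "r = act g r \<or> r = act g (act g r) \<or> r = act g (act g (act g r))"
      using r g(1) by (simp add: inj) blast
    thus ?thesis using five[OF r(1)] by metis
  qed
  define r where "r = act g x \<otimes> inv x"
  have x: "x \<in> carrier G" by fact
  have "act g (x [^] (2::nat)) = x [^] (2::nat)"
    using Suc.prems by (intro Suc.IH) (simp_all add: nat_pow_pow)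
  hence r: "r \<in> carrier G" "r [^] (2::nat) = \<one>"
    using x g by (simp_all add: r_def act_pow nat_pow_distrib nat_pow_inv)
  have rx: "act g x = r \<otimes> x" using x g by (simp add: r_def m_assoc)
  have rr: "r \<otimes> (r \<otimes> y) = y" if "y \<in> carrier G" for y
    using r that by (simp add: numeral_2_eq_2 m_assoc[symmetric])
  have "r \<otimes> x = x"
    using five[OF x] r x g two[OF r] rr by (simp add: rx act_mult)
  with rx show ?case by simp
qed

text \<open>
  With \<open>m = 2\<^sup>k d\<close> and \<open>d\<close> odd, \<open>s = (a b)(c d)\<close> fixes both \<open>d x\<close>, which is 2-primary, and \<open>2\<^sup>k x\<close>, which
  has odd order. Hence \<open>s x - x\<close> is killed by the coprime numbers \<open>d\<close> and \<open>2\<^sup>k\<close>. The fifth letter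
  \<open>e\<close> makes room for writing \<open>s\<close> as the product of the 5-cycles \<open>(a c b d e)\<close> and \<open>(a c b e d)\<close>.
\<close>

lemma double_transposition_fixes_torsion:
  assumes abcde: "distinct [a, b, c, d, e]" "{a, b, c, d, e} \<subseteq> I"
    and few_odd: "\<And>e. odd e \<Longrightarrow> e \<ge> 3 \<Longrightarrow> 
        finite {x \<in> carrier G. x [^] e = \<one>} \<and> card {x \<in> carrier G. x [^] e = \<one>} < e ^ 3"
    and few_two: "finite {x \<in> carrier G. x [^] (2::nat) = \<one>}" "card {x \<in> carrier G. x [^] (2::nat) = \<one>} \<le> 4"
    and x: "x \<in> carrier G" "x [^] m = \<one>" "m > (0::nat)"
  shows "act (transpose a b \<circ> transpose c d) x = x"
proof -
  let ?s = "transpose a b \<circ> transpose c d"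
  let ?t = "transpose a c \<circ> transpose b d"
  \<comment> \<open>The 3-cycle \<open>(b c d)\<close>.\<close>
  let ?c = "transpose b c \<circ> transpose c d"
  let ?g = "transpose a c \<circ> transpose c b \<circ> transpose b d \<circ> transpose d e"
  let ?h = "transpose a c \<circ> transpose c b \<circ> transpose b e \<circ> transpose e d"
  have p: "?s permutes I" "?t permutes I" "?c permutes I" "?g permutes I" "?h permutes I"
    using abcde(2) by (auto intro!: permutes_compose permutes_swap_id)
  have ne: "a \<noteq> b" "b \<noteq> a" "a \<noteq> c" "c \<noteq> a" "a \<noteq> d" "d \<noteq> a" "a \<noteq> e" "e \<noteq> a" "b \<noteq> c" "c \<noteq> b"
    "b \<noteq> d" "d \<noteq> b" "b \<noteq> e" "e \<noteq> b" "c \<noteq> d" "d \<noteq> c" "c \<noteq> e" "e \<noteq> c" "d \<noteq> e" "e \<noteq> d"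
    using abcde(1) by auto
  have ext5: "f = f'" if "f a = f' a" "f b = f' b" "f c = f' c" "f d = f' d" "f e = f' e"
     "\<And>x. x \<noteq> a \<Longrightarrow> x \<noteq> b \<Longrightarrow> x \<noteq> c \<Longrightarrow> x \<noteq> d \<Longrightarrow> x \<noteq> e \<Longrightarrow> f x = f' x" for f f' :: "'i \<Rightarrow> 'i"
  proof (rule ext)
    fix x show "f x = f' x" using that by (cases "x \<in> {a, b, c, d, e}") auto
  qed
  have eqs: "?s \<circ> ?s = id" "?t \<circ> ?t = id" "?s \<circ> ?t = ?t \<circ> ?s" "?t \<circ> ?c = ?c \<circ> ?s" "?s \<circ> ?t \<circ> ?c = ?c \<circ> ?t"
    by (rule ext5; simp add: transpose_def ne)+
  have five: "?g \<circ> ?g \<circ> ?g \<circ> ?g \<circ> ?g = id" "?h \<circ> ?h \<circ> ?h \<circ> ?h \<circ> ?h = id"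
    by (rule ext5; simp add: transpose_def ne)+
  have gh: "?s = ?g \<circ> ?h"
    by (rule ext5; simp add: transpose_def ne)+
  obtain k d where m: "m = 2 ^ k * d" "odd d" 
    using multiplicity_decompose'[of m "2::nat"] x(3) by (metis nat_neq_iff not_prime_unit two_is_prime_nat)
  define y where "y = act ?s x \<otimes> inv x"
  have y: "y \<in> carrier G" using x p by (simp add: y_def del: o_apply)
  have "act ?s (x [^] d) = x [^] d"
  proof -
    have "(x [^] d) [^] ((2::nat) ^ k) = \<one>" using x m by (simp add: nat_pow_pow mult.commute)
    hence "act ?g (x [^] d) = x [^] d" "act ?h (x [^] d) = x [^] d"
      using five_cycle_fixes_two_power_torsion[OF p(4) five(1) few_two, of "x [^] d"]
        five_cycle_fixes_two_power_torsion[OF p(5) five(2) few_two, of "x [^] d"] x by auto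
    thus ?thesis unfolding gh using p x by (simp add: act_comp del: o_apply)
  qed
  hence "y [^] d = \<one>" using x p(1) by (simp add: y_def act_pow nat_pow_distrib nat_pow_inv del: o_apply)
  moreover have "act ?s (x [^] ((2::nat) ^ k)) = x [^] ((2::nat) ^ k)"
    using klein_four_fixes_odd_torsion[OF p(1-3) eqs few_odd, of "x [^] ((2::nat) ^ k)" d] x m
    by (simp add: nat_pow_pow)
  hence "y [^] ((2::nat) ^ k) = \<one>" using x p(1) by (simp add: y_def act_pow nat_pow_distrib nat_pow_inv del: o_apply)
  ultimately have "ord y dvd d" "ord y dvd 2 ^ k" using y pow_eq_id by auto
  moreover have "coprime d (2 ^ k)" using m(2) by simp
  ultimately have "ord y = 1" using coprime_common_divisor_nat by blast
  hence "y = \<one>" using y ord_eq_1 by auto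
  thus ?thesis using x p(1) unfolding y_def
    by (metis act_closed inv_closed inv_equality inv_inv)
qed

text \<open>
  If a transposition fixes \<open>x\<close>, so does every transposition disjoint from it, because their product
  is a double transposition. Five letters suffice to reach any transposition from \<open>(a b)\<close> in at
  most two such moves: if \<open>(i j)\<close> and \<open>(a b)\<close> have one letter in common, two letters \<open>c\<close>, \<open>d\<close> lie
  outside both.
\<close>

theorem transposition_fixes_torsion:
  assumes few_odd: "\<And>e. odd e \<Longrightarrow> e \<ge> 3 \<Longrightarrow> 
        finite {x \<in> carrier G. x [^] e = \<one>} \<and> card {x \<in> carrier G. x [^] e = \<one>} < e ^ 3"
    and few_two: "finite {x \<in> carrier G. x [^] (2::nat) = \<one>}" "card {x \<in> carrier G. x [^] (2::nat) = \<one>} \<le> 4"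
    and x: "x \<in> carrier G" "x [^] m = \<one>" "m > (0::nat)"
    and I: "finite I" "card I \<ge> 5"
    and ab: "a \<in> I" "b \<in> I" "a \<noteq> b" "act (transpose a b) x = x"
    and ij: "i \<in> I" "j \<in> I" "i \<noteq> j"
  shows "act (transpose i j) x = x"
proof -
  have ex: "\<exists>e. e \<in> I - S" if "finite S" "card S < 5" for S
  proof -
    have "I - S \<noteq> {}" using that I card_mono[of S I] by auto
    thus ?thesis by blast
  qed
  have double: "act (transpose p q \<circ> transpose r s) x = x" if "distinct [p, q, r, s]" "{p, q, r, s} \<subseteq> I" for p q r s
  proof -
    obtain e where "e \<in> I - {p, q, r, s}" using ex[of "{p, q, r, s}"] card_length[of "[p, q, r, s]"] by auto
    thus ?thesis using double_transposition_fixes_torsion[OF _ _ few_odd few_two x, of p q r s e] that by auto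
  qed
  have perm: "transpose p q permutes I" if "p \<in> I" "q \<in> I" for p q using that by (rule permutes_swap_id)
  have swap: "act (transpose r s) x = x"
    if "distinct [p, q, r, s]" "{p, q, r, s} \<subseteq> I" "act (transpose p q) x = x" for p q r s
  proof -
    have "act (transpose p q) (act (transpose r s) x) = act (transpose p q) x"
      using double[OF that(1,2)] that perm x by (simp add: act_comp)
    thus ?thesis using act_inj[OF perm[of p q], of "act (transpose r s) x" x] that(2) perm x by simp
  qed
  show ?thesis
  proof (cases "{i, j} = {a, b}")
    case True thus ?thesis using ab by (auto simp: doubleton_eq_iff transpose_commute)
  next
    case False
    show ?thesis
    proof (cases "{i, j} \<inter> {a, b} = {}")
      case True thus ?thesis using swap[of a b i j] ab ij by auto
    next
      case F: False
      have "card ({a, b} \<union> {i, j}) \<le> 3"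
      proof -
        have "card ({a, b} \<inter> {i, j}) \<ge> 1" using F by (simp add: Int_commute Suc_le_eq card_gt_0_iff)
        moreover have "card {a, b} = 2" "card {i, j} = 2" using ab ij by auto
        ultimately show ?thesis using card_Un_Int[of "{a, b}" "{i, j}"] by simp
      qed
      then obtain c where c: "c \<in> I - ({a, b} \<union> {i, j})" using ex[of "{a, b} \<union> {i, j}"] by auto
      have "card (insert c ({a, b} \<union> {i, j})) < 5"
        using \<open>card ({a, b} \<union> {i, j}) \<le> 3\<close> by (intro le_less_trans[OF card_insert_le_m1[of 4]]) auto
      then obtain d where "d \<in> I - insert c ({a, b} \<union> {i, j})" using ex by (metis finite.intros finite_Un)
      with c show ?thesis using swap[of a b c d] swap[of c d i j] ab ij by auto
    qed
  qed
qed

end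

section \<open>Galois theory of polynomials with full symmetric group\<close>

definition poly_over :: "'a::zero set \<Rightarrow> 'a poly \<Rightarrow> bool" where
  "poly_over F p \<longleftrightarrow> (\<forall>i. Polynomial.coeff p i \<in> F)"

lemma poly_over_pCons: "poly_over F (pCons a p) \<longleftrightarrow> a \<in> F \<and> poly_over F p"
  by (auto simp: poly_over_def coeff_pCons split: nat.splits)

lemma poly_over_0: "poly_over F 0 \<longleftrightarrow> 0 \<in> F"
  by (simp add: poly_over_def)

lemma poly_over_mono: "F \<subseteq> F' \<Longrightarrow> poly_over F p \<Longrightarrow> poly_over F' p"
  by (auto simp: poly_over_def)

lemma ring_eval_eq_poly:
  "ring.eval ring_of_type_algebra p (x :: 'a::field) = poly (Poly (rev p)) x"
proof -
  interpret R: field "ring_of_type_algebra :: 'a ring" by (rule field_from_type_algebra)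
  have "x [^]\<^bsub>ring_of_type_algebra\<^esub> (n::nat) = x ^ n" for n
    by (induction n) (auto simp: mult.commute)
  thus ?thesis
    by (induction p) (auto simp: Poly_append poly_monom add.commute)
qed

lemma algebraic_closure_root:
  fixes p :: "'a::field poly"
  assumes "algebraic_closure (ring_of_type_algebra :: 'a ring) K" "Polynomial.degree p > 0"
  shows "\<exists>x. poly p x = 0"
proof -
  interpret algebraic_closure "ring_of_type_algebra :: 'a ring" K by fact
  define P where "P = rev (Polynomial.coeffs p)"
  have deg: "Polynomials.degree P = Polynomial.degree p"
    by (auto simp: P_def degree_eq_length_coeffs)
  have carrier_P: "P \<in> carrier (poly_ring ring_of_type_algebra)"
    using assms(2) by (auto simp: univ_poly_def polynomial_def P_def hd_rev last_coeffs_eq_coeff_degree)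
  hence "splitted P" using roots_over_carrier by blast
  hence "roots P \<noteq> {#}" unfolding splitted_def using deg assms(2) by auto
  then obtain x where "x \<in># roots P" by blast
  hence "is_root P x" using roots_mem_iff_is_root[OF carrier_P] by auto
  hence "poly (Poly (rev P)) x = 0" by (simp add: is_root_def ring_eval_eq_poly)
  thus ?thesis by (auto simp: P_def)
qed

lemma algebraic_closure_algebraic:
  fixes x :: "'a::field"
  assumes "algebraic_closure (ring_of_type_algebra :: 'a ring) K"
  shows "\<exists>p. poly_over K p \<and> p \<noteq> 0 \<and> poly p x = 0"
proof -
  interpret algebraic_closure "ring_of_type_algebra :: 'a ring" K by fact
  obtain P where P: "P \<in> carrier (K[X]\<^bsub>ring_of_type_algebra\<^esub>)" "P \<noteq> []" "eval P x = 0"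
    using algebraicE[OF subfieldE(1)[OF subfield_axioms] _ algebraic_extension, of x] by auto
  define p where "p = Poly (rev P)"
  have K0: "0 \<in> K" using subfield_closed(1)[OF subfield_axioms] .
  have "set P \<subseteq> K" "hd P \<noteq> 0"
    using P(1,2) by (auto simp: univ_poly_def polynomial_def)
  hence "poly_over K p" 
    using K0 by (auto simp: poly_over_def p_def nth_default_def rev_nth subset_iff)
  moreover have "Polynomial.coeff p (length P - 1) = hd P"
    using P(2) by (simp add: p_def nth_default_def rev_nth hd_conv_nth)
  hence "p \<noteq> 0" using \<open>hd P \<noteq> 0\<close> by auto
  moreover have "poly p x = 0" using P(3) by (simp add: p_def ring_eval_eq_poly)
  ultimately show ?thesis by blast
qed

lemma adjoin_subfield: "subfield (adjoin K S) (ring_of_type_algebra :: 'a::field ring)"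
proof -
  interpret R: field "ring_of_type_algebra :: 'a ring" by (rule field_from_type_algebra)
  show ?thesis unfolding adjoin_def by (rule R.generate_field_is_subfield) simp
qed

lemma subset_adjoin: "K \<subseteq> adjoin K S" "S \<subseteq> adjoin K S"
  by (auto simp: adjoin_def intro: generate_field.incl)

lemma adjoin_least:
  fixes F :: "'a::field set"
  assumes "subfield F ring_of_type_algebra" "K \<subseteq> F" "S \<subseteq> F"
  shows "adjoin K S \<subseteq> F"
proof -
  interpret R: field "ring_of_type_algebra :: 'a ring" by (rule field_from_type_algebra)
  show ?thesis unfolding adjoin_def using assms by (intro R.generate_field_min_subfield1) auto
qed

lemma adjoin_mono: "S \<subseteq> S' \<Longrightarrow> adjoin K S \<subseteq> adjoin K (S' :: 'a::field set)"
  using adjoin_least[OF adjoin_subfield, of K K S' S] subset_adjoin[of K S'] subset_adjoin[where S=S'] by (metis order.trans)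

lemma poly_closed:
  assumes "\<And>x y. x \<in> S \<Longrightarrow> y \<in> S \<Longrightarrow> x + y \<in> S" "\<And>x y. x \<in> S \<Longrightarrow> y \<in> S \<Longrightarrow> x * y \<in> S" "0 \<in> S"
    and "poly_over S p" "x \<in> S"
  shows "poly p (x :: 'a::comm_ring_1) \<in> S"
  using assms(4) by (induction p) (auto simp: assms(1-3,5) poly_over_pCons)

text \<open>
  If \<open>c + x r(x) = 0\<close> with \<open>c \<noteq> 0\<close> and \<open>r\<close> over \<open>K\<close>, then \<open>- r(x) / c\<close> is the inverse of \<open>x\<close>. Dividing by
  a power of the variable gives any algebraic equation of \<open>x\<close> a nonzero constant term.
\<close>

lemma subring_of_algebraic_is_subfield:
  fixes K S :: "'a::field set"
  assumes K: "subfield K ring_of_type_algebra" and alg: "\<And>x. \<exists>p. poly_over K p \<and> p \<noteq> 0 \<and> poly p x = 0"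
    and S: "K \<subseteq> S" "\<And>x y. x \<in> S \<Longrightarrow> y \<in> S \<Longrightarrow> x + y \<in> S" "\<And>x y. x \<in> S \<Longrightarrow> y \<in> S \<Longrightarrow> x * y \<in> S"
  shows "subfield S ring_of_type_algebra"
proof -
  have S0: "0 \<in> S" "1 \<in> S" "- 1 \<in> S" 
    using subfield_closed(1,2)[OF K] subfield_closed(4)[OF K, of 1] S(1) by auto
  have minus: "- x \<in> S" if "x \<in> S" for x using S(3)[OF S0(3) that] by simp
  have inv: "inverse x \<in> S" if x: "x \<in> S" for x
  proof (cases "x = 0")
    case False
    have nz: "\<exists>c r. poly_over K (pCons c r) \<and> c \<noteq> 0 \<and> poly (pCons c r) x = 0"
      if "poly_over K p" "p \<noteq> 0" "poly p x = 0" for p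
      using that
    proof (induction p)
      case (pCons c r)
      thus ?case using False by (cases "c = 0") (auto simp: poly_over_pCons)
    qed simp
    obtain p where "poly_over K p" "p \<noteq> 0" "poly p x = 0" using alg[of x] by blast
    from nz[OF this] obtain c r where cr: "poly_over K (pCons c r)" "c \<noteq> 0" "c + x * poly r x = 0"
      by auto
    have "poly r x \<in> S"
      using cr(1) poly_over_mono[OF S(1)] by (intro poly_closed S S0 x) (auto simp: poly_over_pCons)
    moreover have "inverse c \<in> S" using cr(1) subfield_closed(5)[OF K] S(1) by (auto simp: poly_over_pCons)
    moreover have "inverse x = - (poly r x * inverse c)"
    proof (rule inverse_unique)
      have "x * poly r x = - c" using cr(3) by (simp add: eq_neg_iff_add_eq_0 add.commute)
      thus "x * - (poly r x * inverse c) = 1" using cr(2) by (simp flip: mult.assoc)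
    qed
    ultimately show ?thesis using S(3) minus by simp
  qed (use S0 in auto)
  show ?thesis unfolding subfield_of_type_iff by (simp add: S0 minus inv S(2,3))
qed

lemma subfield_sum_closed: 
  assumes "subfield F (ring_of_type_algebra :: 'a::field ring)" "\<And>i. i \<in> A \<Longrightarrow> h i \<in> F"
  shows "sum h A \<in> F"
  using assms(2) by (induction A rule: infinite_finite_induct) (auto simp: subfield_closed[OF assms(1)])

lemma poly_over_closed:
  assumes F: "subfield F (ring_of_type_algebra :: 'a::field ring)" and pq: "poly_over F p" "poly_over F q"
  shows "poly_over F (p + q)" "poly_over F (p - q)" "poly_over F (p * q)"
  using pq by (auto simp: poly_over_def coeff_mult subfield_closed[OF F] intro!: subfield_sum_closed[OF F])

text \<open>
  Since everything is algebraic, the polynomial expressions in \<open>a\<close> already form a field.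
\<close>

lemma adjoin_insert:
  fixes K :: "'a::field set"
  assumes K: "subfield K ring_of_type_algebra" and alg: "\<And>x. \<exists>p. poly_over K p \<and> p \<noteq> 0 \<and> poly p x = 0"
    and x: "x \<in> adjoin K (insert a S)"
  shows "\<exists>h. poly_over (adjoin K S) h \<and> x = poly h a"
proof -
  let ?F = "adjoin K S"
  define R where "R = {poly h a | h. poly_over ?F h}"
  have F: "subfield ?F ring_of_type_algebra" by (rule adjoin_subfield)
  have const: "y \<in> R" if "y \<in> ?F" for y
    using that subfield_closed(1)[OF F] unfolding R_def
    by (intro CollectI exI[of _ "[:y:]"]) (simp add: poly_over_pCons poly_over_0)
  have "subfield R ring_of_type_algebra"
  proof (rule subring_of_algebraic_is_subfield[OF K alg])
    show "K \<subseteq> R" using const subset_adjoin(1) by blast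
    fix u v assume "u \<in> R" "v \<in> R"
    then obtain p q where "u = poly p a" "v = poly q a" "poly_over ?F p" "poly_over ?F q"
      by (auto simp: R_def)
    hence "u + v = poly (p + q) a \<and> poly_over ?F (p + q)" "u * v = poly (p * q) a \<and> poly_over ?F (p * q)"
      using poly_over_closed[OF F, of p q] by simp_all
    thus "u + v \<in> R" "u * v \<in> R" unfolding R_def by blast+
  qed
  moreover have "a \<in> R" unfolding R_def using subfield_closed(1,2)[OF F]
    by (intro CollectI exI[of _ "[:0, 1:]"]) (simp add: poly_over_pCons poly_over_0)
  ultimately have "adjoin K (insert a S) \<subseteq> R"
    using const subset_adjoin[of K S] subset_adjoin[where S=S] by (intro adjoin_least) blast+
  thus ?thesis using x by (auto simp: R_def)
qed

lemma poly_over_reduce: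
  assumes F: "subfield F (ring_of_type_algebra :: 'a::field ring)"
    and g: "poly_over F g" "Polynomial.lead_coeff g = 1" "Polynomial.degree g > 0" "poly g a = 0"
  shows "poly_over F h \<Longrightarrow> \<exists>h'. poly_over F h' \<and> Polynomial.degree h' < Polynomial.degree g \<and> poly h' a = poly h a"
proof (induction "Polynomial.degree h" arbitrary: h rule: less_induct)
  case less
  show ?case
  proof (cases "Polynomial.degree h < Polynomial.degree g")
    case False
    define k where "k = Polynomial.degree h - Polynomial.degree g"
    define c where "c = Polynomial.lead_coeff h"
    define h2 where "h2 = h - Polynomial.monom c k * g"
    have "poly_over F (Polynomial.monom c k)"
      using less.prems subfield_closed(1)[OF F] by (auto simp: poly_over_def c_def)
    hence h2: "poly_over F h2" "poly h2 a = poly h a"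
      unfolding h2_def using less.prems g poly_over_closed[OF F] by auto
    have dg: "k + Polynomial.degree g = Polynomial.degree h" using False by (simp add: k_def)
    have "Polynomial.degree h2 \<le> Polynomial.degree h"
      unfolding h2_def using degree_mult_le[of "Polynomial.monom c k" g] degree_monom_le[of c k] dg
      by (intro degree_diff_le) auto
    moreover have "Polynomial.coeff h2 (Polynomial.degree h) = 0"
      using g(2) by (simp add: h2_def c_def coeff_monom_mult flip: dg)
    hence "Polynomial.degree h2 \<noteq> Polynomial.degree h"
      using False g(3) by (metis degree_0 leading_coeff_0_iff less_nat_zero_code not_gr_zero)
    ultimately show ?thesis using less.hyps[of h2] h2 by auto
  qed (use less.prems in auto)
qed

lemma poly_over_linear_quotient:
  assumes F: "subfield F (ring_of_type_algebra :: 'a::field ring)"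
    and a: "a \<in> F" and p: "poly_over F ([:- a, 1:] * q)"
  shows "poly_over F q"
proof -
  have "\<forall>i \<ge> Suc (Polynomial.degree q) - j. Polynomial.coeff q i \<in> F" for j
  proof (induction j)
    case 0 thus ?case using coeff_eq_0[of q] subfield_closed(1)[OF F] by (auto simp: Suc_le_eq)
  next
    case (Suc j)
    show ?case
    proof (intro allI impI)
      fix i assume i: "i \<ge> Suc (Polynomial.degree q) - Suc j"
      hence "Polynomial.coeff q (Suc i) \<in> F" using Suc.IH by auto
      moreover have "Polynomial.coeff ([:- a, 1:] * q) (Suc i) \<in> F"
        using p unfolding poly_over_def by blast
      moreover have "Polynomial.coeff q i = Polynomial.coeff ([:- a, 1:] * q) (Suc i) + a * Polynomial.coeff q (Suc i)"
        by simp
      ultimately show "Polynomial.coeff q i \<in> F" using a subfield_closed[OF F] by metis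
    qed
  qed
  from this[of "Suc (Polynomial.degree q)"] show ?thesis by (simp add: poly_over_def)
qed

lemma poly_over_prod_quotient:
  assumes F: "subfield F (ring_of_type_algebra :: 'a::field ring)" and "finite S" "S \<subseteq> F"
  shows "poly_over F ((\<Prod>a\<in>S. [:- a, 1:]) * q) \<Longrightarrow> poly_over F q"
  using assms(2,3)
proof (induction S arbitrary: q)
  case (insert a S)
  have "poly_over F ([:- a, 1:] * ((\<Prod>a\<in>S. [:- a, 1:]) * q))"
    using insert.prems(1) unfolding prod.insert[OF insert.hyps] mult.assoc .
  hence "poly_over F ((\<Prod>a\<in>S. [:- a, 1:]) * q)"
    using poly_over_linear_quotient[OF F] insert.prems(2) by blast
  thus ?case using insert by blast
qed simp

definition field_hom_on :: "'a::field set \<Rightarrow> ('a \<Rightarrow> 'a) \<Rightarrow> bool" where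
  "field_hom_on M \<sigma> \<longleftrightarrow> \<sigma> 1 = 1 \<and> (\<forall>x\<in>M. \<forall>y\<in>M. \<sigma> (x + y) = \<sigma> x + \<sigma> y \<and> \<sigma> (x * y) = \<sigma> x * \<sigma> y)"

lemma field_hom_on_simps:
  assumes M: "subfield M (ring_of_type_algebra :: 'a::field ring)" and \<sigma>: "field_hom_on M \<sigma>"
  shows "\<sigma> 1 = 1" "\<sigma> 0 = 0"
    "x \<in> M \<Longrightarrow> y \<in> M \<Longrightarrow> \<sigma> (x + y) = \<sigma> x + \<sigma> y" "x \<in> M \<Longrightarrow> y \<in> M \<Longrightarrow> \<sigma> (x * y) = \<sigma> x * \<sigma> y"
    "x \<in> M \<Longrightarrow> \<sigma> (- x) = - \<sigma> x" "x \<in> M \<Longrightarrow> y \<in> M \<Longrightarrow> \<sigma> (x - y) = \<sigma> x - \<sigma> y"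
    "x \<in> M \<Longrightarrow> \<sigma> (inverse x) = inverse (\<sigma> x)" "x \<in> M \<Longrightarrow> y \<in> M \<Longrightarrow> \<sigma> (x / y) = \<sigma> x / \<sigma> y"
    "x \<in> M \<Longrightarrow> \<sigma> (x ^ n) = \<sigma> x ^ n" "\<sigma> (numeral k) = numeral k"
    "x \<in> M \<Longrightarrow> \<sigma> x = 0 \<longleftrightarrow> x = 0" "x \<in> M \<Longrightarrow> y \<in> M \<Longrightarrow> \<sigma> x = \<sigma> y \<longleftrightarrow> x = y"
proof -
  note cl = subfield_closed[OF M]
  show one: "\<sigma> 1 = 1" and add: "x \<in> M \<Longrightarrow> y \<in> M \<Longrightarrow> \<sigma> (x + y) = \<sigma> x + \<sigma> y"
    and mult: "x \<in> M \<Longrightarrow> y \<in> M \<Longrightarrow> \<sigma> (x * y) = \<sigma> x * \<sigma> y" for x y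
    using \<sigma> by (auto simp: field_hom_on_def)
  show zero: "\<sigma> 0 = 0" using add[OF cl(1) cl(1)] by (metis add.right_neutral add_left_cancel)
  show minus: "x \<in> M \<Longrightarrow> \<sigma> (- x) = - \<sigma> x" for x
    using add[of x "- x"] cl zero by (simp add: eq_neg_iff_add_eq_0 add.commute)
  show diff: "x \<in> M \<Longrightarrow> y \<in> M \<Longrightarrow> \<sigma> (x - y) = \<sigma> x - \<sigma> y" for x y
    using add[of x "- y"] minus[of y] cl by simp
  show inv: "x \<in> M \<Longrightarrow> \<sigma> (inverse x) = inverse (\<sigma> x)" for x
    using mult[of x "inverse x"] cl zero one by (cases "x = 0") (auto simp: inverse_unique)
  show "x \<in> M \<Longrightarrow> y \<in> M \<Longrightarrow> \<sigma> (x / y) = \<sigma> x / \<sigma> y"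
    using mult[of x "inverse y"] inv cl by (simp add: divide_inverse)
  show "x \<in> M \<Longrightarrow> \<sigma> (x ^ n) = \<sigma> x ^ n"
    by (induction n) (auto simp: one mult cl)
  have "\<sigma> (of_nat m) = of_nat m \<and> of_nat m \<in> M" for m
    by (induction m) (auto simp: zero one add cl)
  from this[of "numeral k"] show "\<sigma> (numeral k) = numeral k" by simp
  show eq0: "x \<in> M \<Longrightarrow> \<sigma> x = 0 \<longleftrightarrow> x = 0" for x
    using mult[of x "inverse x"] one zero cl by (cases "x = 0") auto
  show "x \<in> M \<Longrightarrow> y \<in> M \<Longrightarrow> \<sigma> x = \<sigma> y \<longleftrightarrow> x = y"
    using eq0[of "x - y"] diff cl by auto
qed

lemma field_hom_on_eq_adjoin:
  assumes "subfield M (ring_of_type_algebra :: 'a::field ring)" "field_hom_on M \<sigma>" "field_hom_on M \<tau>"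
    and "K \<union> S \<subseteq> M" "\<And>x. x \<in> K \<union> S \<Longrightarrow> \<sigma> x = \<tau> x" and x: "x \<in> adjoin K S"
  shows "\<sigma> x = \<tau> x"
proof -
  have "subfield {x \<in> M. \<sigma> x = \<tau> x} ring_of_type_algebra"
    unfolding subfield_of_type_iff
    by (simp add: field_hom_on_simps[OF assms(1,2)] field_hom_on_simps[OF assms(1,3)] subfield_closed[OF assms(1)])
  thus ?thesis using adjoin_least[of "{x \<in> M. \<sigma> x = \<tau> x}" K S] assms(4,5) x by auto
qed

lemma field_hom_on_poly:
  assumes M: "subfield M (ring_of_type_algebra :: 'a::field ring)" and \<sigma>: "field_hom_on M \<sigma>"
    and p: "poly_over M p" "\<And>i. \<sigma> (Polynomial.coeff p i) = Polynomial.coeff p i" and x: "x \<in> M"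
  shows "\<sigma> (poly p x) = poly p (\<sigma> x)"
  using p
proof (induction p)
  case 0 thus ?case using field_hom_on_simps[OF M \<sigma>] by simp
next
  case (pCons a p)
  have p: "poly_over M p" and a: "a \<in> M" using pCons.prems by (auto simp: poly_over_pCons)
  have "\<sigma> a = a" "\<And>i. \<sigma> (Polynomial.coeff p i) = Polynomial.coeff p i"
    using pCons.prems(2)[of 0] pCons.prems(2)[of "Suc _"] by simp_all
  moreover have "poly p x \<in> M" using p x by (intro poly_closed) (auto simp: subfield_closed[OF M])
  ultimately show ?case using pCons.IH[OF p] a x
    by (simp add: field_hom_on_simps[OF M \<sigma>] subfield_closed[OF M])
qed

text \<open>
  The roots are removed one at a time. Suppose \<open>x\<close> lies in \<open>F(a)\<close>, where \<open>F\<close> is generated by the roots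
  in \<open>S\<close>. The polynomial with the roots in \<open>A - S\<close> has coefficients in \<open>F\<close>, so \<open>x = h(a)\<close> with
  \<open>deg h < |A - S|\<close>. The transposition of \<open>a\<close> with another \<open>b\<close> in \<open>A - S\<close> fixes \<open>F\<close> and \<open>x\<close>, hence also
  \<open>x = h(b)\<close>. Thus \<open>h - x\<close> has more roots than its degree allows, so \<open>h\<close> is the constant \<open>x\<close>.
\<close>

theorem fixed_by_transpositions_imp_base:
  fixes K :: "'a::field set" and A :: "'a set"
  assumes K: "subfield K ring_of_type_algebra" and alg: "\<And>x. \<exists>p. poly_over K p \<and> p \<noteq> 0 \<and> poly p x = 0"
    and A: "finite A" and f: "poly_over K (\<Prod>a\<in>A. [:- a, 1:])"
    and \<sigma>: "\<And>a b. a \<in> A \<Longrightarrow> b \<in> A \<Longrightarrow> field_hom_on (adjoin K A) (\<sigma> a b) \<and> (\<forall>y\<in>K. \<sigma> a b y = y)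
               \<and> (\<forall>c\<in>A. \<sigma> a b c = transpose a b c) \<and> \<sigma> a b x = x"
    and x: "x \<in> adjoin K A"
  shows "x \<in> K"
proof -
  let ?M = "adjoin K A"
  have M: "subfield ?M ring_of_type_algebra" by (rule adjoin_subfield)
  have "finite S \<Longrightarrow> S \<subseteq> A \<Longrightarrow> x \<in> adjoin K S \<Longrightarrow> x \<in> K" for S
  proof (induction S rule: finite_induct)
    case empty
    thus ?case using adjoin_least[OF K, of K "{}"] by auto
  next
    case (insert a S)
    let ?F = "adjoin K S"
    have F: "subfield ?F ring_of_type_algebra" by (rule adjoin_subfield)
    have FM: "?F \<subseteq> ?M" using insert.prems by (intro adjoin_mono) auto
    define g where "g = (\<Prod>b\<in>A - S. [:- b, 1:])"
    have fin: "finite (A - S)" and a: "a \<in> A - S" using A insert by auto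
    have "(\<Prod>b\<in>A. [:- b, 1:]) = (\<Prod>b\<in>S. [:- b, 1:]) * g"
      unfolding g_def using insert A by (subst prod.subset_diff[of S A]) (auto simp: mult.commute)
    hence "poly_over ?F ((\<Prod>b\<in>S. [:- b, 1:]) * g)"
      using f subset_adjoin(1)[of K S] by (auto simp: poly_over_def)
    hence "poly_over ?F g" using poly_over_prod_quotient[OF F insert.hyps(1) subset_adjoin(2)] by blast
    moreover have "Polynomial.lead_coeff g = 1" unfolding g_def by (simp add: lead_coeff_prod)
    moreover have deg: "Polynomial.degree g = card (A - S)" unfolding g_def by (subst degree_prod_eq_sum_degree) auto
    moreover have "poly g a = 0" unfolding g_def using a fin by (auto simp: poly_prod)
    moreover have "card (A - S) > 0" using a fin card_gt_0_iff by blast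
    moreover obtain h0 where "poly_over ?F h0" "x = poly h0 a"
      using adjoin_insert[OF K alg] insert.prems by blast
    ultimately obtain h where h: "poly_over ?F h" "Polynomial.degree h < card (A - S)" "poly h a = x"
      using poly_over_reduce[OF F, of g a h0] by auto
    have root: "poly h b = x" if b: "b \<in> A - S" for b
    proof -
      have ab: "field_hom_on ?M (\<sigma> a b)" "\<And>y. y \<in> K \<Longrightarrow> \<sigma> a b y = y"
        "\<And>c. c \<in> A \<Longrightarrow> \<sigma> a b c = transpose a b c" "\<sigma> a b x = x"
        using \<sigma>[of a b] a b by auto
      have id: "field_hom_on ?M (\<lambda>y. y)" by (simp add: field_hom_on_def)
      have "\<sigma> a b y = y" if "y \<in> ?F" for y
      proof (rule field_hom_on_eq_adjoin[OF M ab(1) id _ _ that])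
        show "K \<union> S \<subseteq> ?M" using subset_adjoin[of K A] subset_adjoin[where S=A] insert.prems by blast
        show "\<sigma> a b z = z" if "z \<in> K \<union> S" for z
          using that ab(2,3) a b insert.prems by (auto simp: transpose_def)
      qed
      hence "\<sigma> a b (poly h a) = poly h (\<sigma> a b a)"
        using h(1) FM a subset_adjoin(2)[of A K]
        by (intro field_hom_on_poly[OF M ab(1)]) (auto simp: poly_over_def)
      thus ?thesis using ab(3)[of a] ab(4) h(3) a by simp
    qed
    have "h - [:x:] = 0"
    proof (rule ccontr)
      assume nz: "h - [:x:] \<noteq> 0"
      have "A - S \<subseteq> {b. poly (h - [:x:]) b = 0}" using root by auto
      hence "card (A - S) \<le> card {b. poly (h - [:x:]) b = 0}"
        using poly_roots_finite[OF nz] by (rule card_mono[rotated])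
      also have "\<dots> \<le> Polynomial.degree (h - [:x:])" using card_poly_roots_bound[OF nz] .
      also have "\<dots> \<le> Polynomial.degree h" by (intro degree_diff_le) auto
      finally show False using h(2) by simp
    qed
    hence "h = [:x:]" by simp
    hence "x \<in> ?F" using h(1) by (simp add: poly_over_pCons)
    thus ?case using insert by auto
  qed
  thus ?thesis using A x by blast
qed

lemma splitting_field_subset:
  "subfield (splitting_field K f) (ring_of_type_algebra :: 'a::field ring)"
  "K \<subseteq> splitting_field K f" "{x. poly f x = 0} \<subseteq> splitting_field K f"
  unfolding splitting_field_def by (rule adjoin_subfield subset_adjoin)+

lemma Gal_carrier_iff:
  "\<sigma> \<in> carrier (Gal f K) \<longleftrightarrow> \<sigma> \<in> Bij (splitting_field K f) \<and> field_hom_on (splitting_field K f) \<sigma> \<and> (\<forall>x\<in>K. \<sigma> x = x)"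
  unfolding Gal_def field_aut_group_def
  by (auto simp: ring_hom_def field_hom_on_def ring_of_type_algebra_def dest: Bij_imp_funcset)

text \<open>
  An automorphism is determined by its values on the roots. If the group is as large as the set of
  permutations of the roots, the embedding is onto.
\<close>

theorem Gal_embeds_in_root_permutations:
  fixes K :: "'a::field set" and f :: "'a poly"
  defines "A \<equiv> {x. poly f x = 0}"
  assumes f: "poly_over K f" "f \<noteq> 0"
  shows "card (carrier (Gal f K)) \<le> fact (card A)"
    and "card (carrier (Gal f K)) = fact (card A) \<Longrightarrow> p permutes A \<Longrightarrow>
           \<exists>\<sigma>\<in>carrier (Gal f K). \<forall>a\<in>A. \<sigma> a = p a"
proof -
  let ?M = "splitting_field K f"
  note M = splitting_field_subset[where K=K and f=f]
  have A: "finite A" "A \<subseteq> ?M" using poly_roots_finite[OF f(2)] M(3) by (simp_all add: A_def)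
  define r where "r = (\<lambda>\<sigma> x. if x \<in> A then \<sigma> x else (x :: 'a))"
  have perm: "r \<sigma> permutes A" if "\<sigma> \<in> carrier (Gal f K)" for \<sigma>
  proof -
    from that have h: "field_hom_on ?M \<sigma>" "\<forall>x\<in>K. \<sigma> x = x" by (auto simp: Gal_carrier_iff)
    have "\<sigma> a \<in> A" if "a \<in> A" for a
    proof -
      have "poly f (\<sigma> a) = \<sigma> (poly f a)"
        using f(1) h that A M(2) by (intro field_hom_on_poly[OF M(1) h(1), symmetric]) (auto simp: poly_over_def)
      thus ?thesis using that field_hom_on_simps(2)[OF M(1) h(1)] by (simp add: A_def)
    qed
    moreover have "inj_on \<sigma> A"
      using field_hom_on_simps(12)[OF M(1) h(1)] A(2) by (intro inj_onI) blast
    ultimately have "bij_betw \<sigma> A A"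
      using endo_inj_surj[OF A(1), of \<sigma>] by (auto simp: bij_betw_def)
    hence "bij_betw (r \<sigma>) A A" by (rule bij_betw_cong[THEN iffD1, rotated]) (simp add: r_def)
    thus ?thesis by (rule bij_imp_permutes) (simp add: r_def)
  qed
  have inj: "inj_on r (carrier (Gal f K))"
  proof (rule inj_onI)
    fix \<sigma> \<tau> assume st: "\<sigma> \<in> carrier (Gal f K)" "\<tau> \<in> carrier (Gal f K)" and eq: "r \<sigma> = r \<tau>"
    have "\<sigma> x = \<tau> x" if "x \<in> ?M" for x
    proof (rule field_hom_on_eq_adjoin[OF M(1), where \<sigma> = \<sigma> and \<tau> = \<tau> and K = K and S = A])
      show "x \<in> adjoin K A" using that by (simp add: splitting_field_def A_def)
      fix y assume "y \<in> K \<union> A"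
      thus "\<sigma> y = \<tau> y"
        using st fun_cong[OF eq, of y] by (auto simp: Gal_carrier_iff r_def)
    qed (use st M A in \<open>auto simp: Gal_carrier_iff\<close>)
    thus "\<sigma> = \<tau>" using st by (intro extensionalityI[of _ ?M]) (auto simp: Gal_carrier_iff Bij_def)
  qed
  have img: "r ` carrier (Gal f K) \<subseteq> {p. p permutes A}" using perm by auto
  have fin: "finite {p. p permutes A}" using A(1) by (rule finite_permutations)
  have card: "card {p. p permutes A} = fact (card A)" using A(1) by (simp add: card_permutations)
  show "card (carrier (Gal f K)) \<le> fact (card A)" using card_inj_on_le[OF inj img fin] card by simp
  assume eq: "card (carrier (Gal f K)) = fact (card A)" and p: "p permutes A"
  have "r ` carrier (Gal f K) = {p. p permutes A}"
    using card_seteq[OF fin img] card_image[OF inj] eq card by simp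
  with p obtain \<sigma> where "\<sigma> \<in> carrier (Gal f K)" "p = r \<sigma>" by blast
  thus "\<exists>\<sigma>\<in>carrier (Gal f K). \<forall>a\<in>A. \<sigma> a = p a" by (auto simp: r_def)
qed


section \<open>Torsion over the field generated by all but two roots\<close>

lemma map_point_hom:
  fixes E :: "'a::field_char_0 weierstrass"
  assumes M: "subfield M ring_of_type_algebra" and \<sigma>: "field_hom_on M \<sigma>" "\<sigma> ` M \<subseteq> M"
    and E: "a1 E \<in> M" "a2 E \<in> M" "a3 E \<in> M" "a4 E \<in> M" "a6 E \<in> M"
    and fix': "\<sigma> (a1 E) = a1 E" "\<sigma> (a2 E) = a2 E" "\<sigma> (a3 E) = a3 E" "\<sigma> (a4 E) = a4 E" "\<sigma> (a6 E) = a6 E"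
  shows "map_point \<sigma> \<in> hom (rational_points E M) (rational_points E M)"
proof (rule homI)
  note hs = field_hom_on_simps[OF M \<sigma>(1)] subfield_closed[OF M]
  fix P assume P: "P \<in> carrier (rational_points E M)"
  show "map_point \<sigma> P \<in> carrier (rational_points E M)"
  proof (cases P)
    case (Affine x y)
    with P have xy: "x \<in> M" "y \<in> M" 
      and "\<sigma> (y\<^sup>2 + a1 E * x * y + a3 E * y) = \<sigma> (x ^ 3 + a2 E * x\<^sup>2 + a4 E * x + a6 E)" by auto
    thus ?thesis using Affine \<sigma>(2) E by (auto simp: hs fix')
  qed simp
  fix Q assume Q: "Q \<in> carrier (rational_points E M)"
  show "map_point \<sigma> (P \<otimes>\<^bsub>rational_points E M\<^esub> Q) = map_point \<sigma> P \<otimes>\<^bsub>rational_points E M\<^esub> map_point \<sigma> Q"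
  proof (cases P; cases Q)
    fix x1 y1 x2 y2 assume PQ: "P = Affine x1 y1" "Q = Affine x2 y2"
    have m: "x1 \<in> M" "y1 \<in> M" "x2 \<in> M" "y2 \<in> M" using P Q PQ by auto
    have "\<sigma> x1 = \<sigma> x2 \<longleftrightarrow> x1 = x2" using m by (simp add: hs)
    moreover have "\<sigma> y1 + \<sigma> y2 + a1 E * \<sigma> x2 + a3 E = \<sigma> (y1 + y2 + a1 E * x2 + a3 E)"
      using m E by (simp add: hs fix')
    hence "\<sigma> y1 + \<sigma> y2 + a1 E * \<sigma> x2 + a3 E = 0 \<longleftrightarrow> y1 + y2 + a1 E * x2 + a3 E = 0"
      using m E by (simp only: field_hom_on_simps(11)[OF M \<sigma>(1)] subfield_closed[OF M])
    ultimately show ?thesis unfolding PQ using m E by (simp add: Let_def hs fix')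
  qed auto
qed


theorem theorem1p5:
  fixes K :: "'a::field_char_0 set"
    and E :: "'a weierstrass"
    and f :: "'a poly"
    and \<alpha> :: "nat \<Rightarrow> 'a"
    and n :: nat
    and I :: "nat set"
    and L :: "'a set"
  assumes "algebraic_closure (ring_of_type_algebra :: 'a ring) K"
    and "elliptic_curve_over K E"
    and "\<forall>i. Polynomial.coeff f i \<in> K"
    and "Polynomial.lead_coeff f = 1"
    and "Polynomial.degree f = n"
    and "n \<ge> 5"
    and "f = (\<Prod>i\<in>{1..n}. [:- \<alpha> i, 1:])"
    and "Gal f K \<cong> sym_group n"
    and "I \<subseteq> {1..n}"
    and "card I = n - 2"
    and "L = adjoin K (\<alpha> ` I)"
  shows "torsion_subgroup (rational_points E L) = torsion_subgroup (rational_points E K)"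
proof -
  interpret closure: algebraic_closure "ring_of_type_algebra :: 'a ring" K by fact
  have K: "subfield K (ring_of_type_algebra :: 'a ring)" by (rule closure.subfield_axioms)
  note alg = algebraic_closure_algebraic[OF assms(1)]
  have E: "a1 E \<in> K" "a2 E \<in> K" "a3 E \<in> K" "a4 E \<in> K" "a6 E \<in> K" and disc: "discriminant E \<noteq> 0"
    using assms(2) by (auto simp: elliptic_curve_over_def)
  have f: "poly_over K f" "f \<noteq> 0" using assms(3,4) by (auto simp: poly_over_def)

  define A where "A = {x. poly f x = 0}"
  have A: "A = \<alpha> ` {1..n}" by (auto simp: A_def assms(7) poly_prod)
  have card_Gal: "card (carrier (Gal f K)) = fact n"
    using iso_same_card[OF assms(8)] by (simp add: sym_group_card_carrier)
  \<comment> \<open>The group embeds into the permutations of \<open>A\<close>, so it would be too small if two of the \<open>\<alpha> i\<close> agreed.\<close>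
  have "card A \<le> n" unfolding A using card_image_le[of "{1..n}" \<alpha>] by simp
  moreover have "\<not> card A < n"
  proof
    assume "card A < n"
    moreover have "card A > 0" using assms(6) by (auto simp: A card_gt_0_iff)
    ultimately have "fact (card A) < (fact n :: nat)" by (intro fact_less_mono_nat)
    thus False using Gal_embeds_in_root_permutations(1)[OF f] card_Gal by (simp add: A_def)
  qed
  ultimately have cA: "card A = n" by simp
  have inj: "inj_on \<alpha> {1..n}" using cA unfolding A by (intro eq_card_imp_inj_on) auto
  have fA: "f = (\<Prod>a\<in>A. [:- a, 1:])" unfolding A assms(7) prod.reindex[OF inj] comp_def ..
  have finA: "finite A" by (simp add: A)

  define M where "M = splitting_field K f"
  have MA: "M = adjoin K A" by (simp add: M_def splitting_field_def A_def)
  have M: "subfield M ring_of_type_algebra" "K \<subseteq> M" "A \<subseteq> M"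
    using splitting_field_subset[where K=K and f=f] by (auto simp: M_def A_def)
  have realise: "\<exists>\<sigma>\<in>carrier (Gal f K). \<forall>a\<in>A. \<sigma> a = p a" if "p permutes A" for p
    using Gal_embeds_in_root_permutations(2)[OF f] card_Gal cA that by (simp add: A_def)
  \<comment> \<open>The automorphism of \<open>M\<close> over \<open>K\<close> that permutes the roots by \<open>p\<close>. It is unique on \<open>M\<close>, which makes \<open>aut\<close> respect composition.\<close>
  define aut where "aut = (\<lambda>p. SOME \<sigma>. \<sigma> \<in> carrier (Gal f K) \<and> (\<forall>a\<in>A. \<sigma> a = p a))"
  have aut: "field_hom_on M (aut p)" "aut p ` M \<subseteq> M" "\<forall>x\<in>K. aut p x = x" "\<forall>a\<in>A. aut p a = p a"
    if "p permutes A" for p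
  proof -
    have "aut p \<in> carrier (Gal f K) \<and> (\<forall>a\<in>A. aut p a = p a)"
      unfolding aut_def by (rule someI_ex[of "\<lambda>\<sigma>. \<sigma> \<in> carrier (Gal f K) \<and> (\<forall>a\<in>A. \<sigma> a = p a)"])
        (use realise[OF that] in blast)
    thus "field_hom_on M (aut p)" "aut p ` M \<subseteq> M" "\<forall>x\<in>K. aut p x = x" "\<forall>a\<in>A. aut p a = p a"
      using Bij_imp_funcset[of "aut p" M] by (auto simp: Gal_carrier_iff M_def)
  qed
  have aut_eq: "aut p x = \<tau> x"
    if "p permutes A" "field_hom_on M \<tau>" "\<forall>x\<in>K. \<tau> x = x" "\<forall>a\<in>A. \<tau> a = p a" "x \<in> M" for p \<tau> x
  proof (rule field_hom_on_eq_adjoin[OF M(1) aut(1)[OF that(1)] that(2)])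
    show "K \<union> A \<subseteq> M" using M by simp
    show "x \<in> adjoin K A" using that(5) by (simp add: MA)
    fix y assume "y \<in> K \<union> A"
    thus "aut p y = \<tau> y" using aut(3,4)[OF that(1)] that(3,4) by auto
  qed
  have aut_id: "aut id x = x" if "x \<in> M" for x
    using aut_eq[OF permutes_id, of "\<lambda>x. x"] that by (simp add: field_hom_on_def)
  have aut_comp: "aut (p \<circ> q) x = aut p (aut q x)" if "p permutes A" "q permutes A" "x \<in> M" for p q x
  proof (rule aut_eq[OF permutes_compose[OF that(2,1)]])
    show "field_hom_on M (\<lambda>x. aut p (aut q x))"
      using aut(1,2)[OF that(1)] aut(1,2)[OF that(2)]
      by (auto simp: field_hom_on_def image_subset_iff)
    show "\<forall>a\<in>A. aut p (aut q a) = (p \<circ> q) a"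
      using aut(4)[OF that(1)] aut(4)[OF that(2)] permutes_in_image[OF that(2)] by auto
  qed (use aut(3)[OF that(1)] aut(3)[OF that(2)] that in auto)

  \<comment> \<open>Over an algebraically closed field every \<open>x\<close> is the first coordinate of a point.\<close>
  have inf: "infinite {P. on_curve E P}"
  proof
    assume fin: "finite {P. on_curve E P}"
    have "\<exists>y. on_curve E (Affine x y)" for x
    proof -
      obtain y where "poly [:- (x ^ 3 + a2 E * x\<^sup>2 + a4 E * x + a6 E), a1 E * x + a3 E, 1:] y = 0"
        using algebraic_closure_root[OF assms(1)] by (metis degree_pCons_eq one_neq_zero pCons_eq_0_iff zero_less_Suc)
      thus ?thesis by (intro exI[of _ y]) (simp add: algebra_simps power2_eq_square)
    qed
    then obtain y where "\<And>x. on_curve E (Affine x (y x))" by metis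
    hence "range (\<lambda>x. Affine x (y x)) \<subseteq> {P. on_curve E P}" by blast
    hence "finite (range (\<lambda>x. Affine x (y x)))" using fin finite_subset by blast
    hence "finite (UNIV :: 'a set)" by (rule finite_imageD) (simp add: inj_on_def)
    thus False using infinite_UNIV_char_0 by blast
  qed
  define G where "G = rational_points E M"
  have G_UNIV: "comm_group (rational_points E UNIV)"
    using disc inf by (intro comm_group_rational_points subfield_UNIV) auto
  interpret G: comm_group G
    unfolding G_def using E M disc inf by (intro comm_group_rational_points) auto
  interpret G: symmetric_group_action G A "\<lambda>p. map_point (aut p)"
  proof (unfold_locales, goal_cases)
    case (1 p)
    thus ?case unfolding G_def using aut[OF 1] E M by (intro map_point_hom) auto
  next
    case (2 P) thus ?case using aut_id by (cases P) (auto simp: G_def)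
  next
    case (3 p q P) thus ?case using aut_comp by (cases P) (auto simp: G_def)
  qed
  have few_odd: "finite {P \<in> carrier G. P [^]\<^bsub>G\<^esub> e = \<one>\<^bsub>G\<^esub>} \<and> card {P \<in> carrier G. P [^]\<^bsub>G\<^esub> e = \<one>\<^bsub>G\<^esub>} < e ^ 3"
    if "e \<ge> 3" for e :: nat
  proof -
    let ?T = "{P. on_curve E P \<and> P [^]\<^bsub>rational_points E UNIV\<^esub> e = Infinity}"
    have sub: "{P \<in> carrier G. P [^]\<^bsub>G\<^esub> e = \<one>\<^bsub>G\<^esub>} \<subseteq> ?T"
      using pow_rational_points[of E M _ e] by (auto simp: G_def)
    have T: "finite ?T" "card ?T \<le> 3 * e\<^sup>2 - 2" using card_torsion_le[OF G_UNIV, of e] that by auto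
    have "3 * e\<^sup>2 \<le> e ^ 3" "e\<^sup>2 > 0" using that by (auto simp: power3_eq_cube power2_eq_square)
    hence "3 * e\<^sup>2 - 2 < e ^ 3" by linarith
    with T card_mono[OF T(1) sub] finite_subset[OF sub T(1)] show ?thesis by linarith
  qed
  have two: "{P \<in> carrier G. P [^]\<^bsub>G\<^esub> (2::nat) = \<one>\<^bsub>G\<^esub>} \<subseteq> {P. on_curve E P \<and> point_add E P P = Infinity}"
    by (auto simp: G_def numeral_2_eq_2)
  note few_two = finite_subset[OF two card_two_torsion_le(1)]
    order.trans[OF card_mono[OF card_two_torsion_le(1) two] card_two_torsion_le(2)]

  have L: "subfield L ring_of_type_algebra" "K \<subseteq> L" "\<alpha> ` I \<subseteq> L" "L \<subseteq> M"
    unfolding assms(11) MA using assms(9) A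
    by (intro adjoin_subfield subset_adjoin adjoin_mono; blast)+
  have "finite I" using assms(9) finite_subset by blast
  hence "card ({1..n} - I) = 2" using assms(6,9,10) by (simp add: card_Diff_subset)
  then obtain i j where ij: "{1..n} - I = {i, j}" "i \<noteq> j" by (auto simp: card_2_iff)
  define a b where "a = \<alpha> i" and "b = \<alpha> j"
  have "i \<in> {1..n} - I" "j \<in> {1..n} - I" unfolding ij(1) by simp_all
  hence ij': "i \<in> {1..n}" "j \<in> {1..n}" "i \<notin> I" "j \<notin> I" by simp_all
  have ab: "a \<in> A" "b \<in> A" "a \<noteq> b"
    using ij' ij(2) inj_onD[OF inj, of i j] by (auto simp: A a_def b_def)
  have perm: "transpose c d permutes A" if "c \<in> A" "d \<in> A" for c d using that by (rule permutes_swap_id)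
  \<comment> \<open>The roots \<open>a\<close> and \<open>b\<close> are the two that are not adjoined, so their transposition fixes the generators of \<open>L\<close>.\<close>
  have fix_L: "aut (transpose a b) x = x" if "x \<in> L" for x
  proof (rule field_hom_on_eq_adjoin[OF M(1) aut(1)[OF perm[OF ab(1,2)]]])
    show "field_hom_on M (\<lambda>x. x)" by (simp add: field_hom_on_def)
    show "x \<in> adjoin K (\<alpha> ` I)" using that assms(11) by simp
    show "K \<union> \<alpha> ` I \<subseteq> M" using M L by blast
    fix y assume "y \<in> K \<union> \<alpha> ` I"
    thus "aut (transpose a b) y = y"
    proof
      assume "y \<in> \<alpha> ` I"
      then obtain k where k: "k \<in> I" "y = \<alpha> k" by blast
      with assms(9) have "k \<in> {1..n}" "k \<noteq> i" "k \<noteq> j" using ij' by auto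
      hence "y \<noteq> a" "y \<noteq> b" "y \<in> A"
        using k(2) ij' inj_onD[OF inj, of k i] inj_onD[OF inj, of k j] by (auto simp: a_def b_def A)
      thus ?thesis using aut(4)[OF perm[OF ab(1,2)]] by (simp add: transpose_def)
    qed (use aut(3)[OF perm[OF ab(1,2)]] in blast)
  qed

  show ?thesis
  proof
    show "torsion_subgroup (rational_points E K) \<subseteq> torsion_subgroup (rational_points E L)"
    proof
      fix P assume "P \<in> torsion_subgroup (rational_points E K)"
      moreover have "rational_over K P \<Longrightarrow> rational_over L P" using L(2) by (cases P) auto
      ultimately show "P \<in> torsion_subgroup (rational_points E L)"
        using pow_rational_points[of E K P] pow_rational_points[of E L P] by (auto simp: torsion_subgroup_def)
    qed
    show "torsion_subgroup (rational_points E L) \<subseteq> torsion_subgroup (rational_points E K)"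
    proof
      fix P assume "P \<in> torsion_subgroup (rational_points E L)"
      then obtain m :: nat where P: "on_curve E P" "rational_over L P" and m: "m > 0" "P [^]\<^bsub>rational_points E L\<^esub> m = Infinity"
        by (auto simp: torsion_subgroup_def)
      have "rational_over M P" using P(2) L(4) by (cases P) auto
      hence PG: "P \<in> carrier G" using P(1) by (simp add: G_def)
      have Pm: "P [^]\<^bsub>G\<^esub> m = \<one>\<^bsub>G\<^esub>"
        using m(2) pow_rational_points[of E L P m] pow_rational_points[of E M P m] by (simp add: G_def)
      have "map_point (aut (transpose a b)) P = P"
        using P(2) fix_L by (cases P) auto
      hence fixed: "map_point (aut (transpose c d)) P = P" if "c \<in> A" "d \<in> A" for c d
        using G.transposition_fixes_torsion[OF _ few_two PG Pm m(1) finA _ ab, of c d] few_odd that cA assms(6) 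
          G.act_id[OF PG] by (cases "c = d") auto
      have "rational_over K P"
      proof (cases P)
        case (Affine x y)
        have "z \<in> K" if "z \<in> {x, y}" for z
        proof (rule fixed_by_transpositions_imp_base[OF K alg finA, of "\<lambda>c d. aut (transpose c d)"])
          show "poly_over K (\<Prod>a\<in>A. [:- a, 1:])" using f(1) fA by simp
          show "z \<in> adjoin K A" using that PG Affine by (auto simp: G_def MA)
          fix c d assume cd: "c \<in> A" "d \<in> A"
          show "field_hom_on (adjoin K A) (aut (transpose c d)) \<and> (\<forall>y\<in>K. aut (transpose c d) y = y) \<and>
            (\<forall>e\<in>A. aut (transpose c d) e = transpose c d e) \<and> aut (transpose c d) z = z"
            using aut[OF perm[OF cd]] fixed[OF cd] that Affine by (auto simp: MA)
        qed
        thus ?thesis by (simp add: Affine)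
      qed simp
      thus "P \<in> torsion_subgroup (rational_points E K)"
        using P m pow_rational_points[of E L P m] pow_rational_points[of E K P m] by (auto simp: torsion_subgroup_def)
    qed
  qed
qed

end
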